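(* Let $\mu>0$ be fixed and let $\tau=\mu h$. Let $\Omega_0\subset\mathbb{R}^2$ be a bounded domain with smooth boundary such that for some $c_0>0$ $$\Omega_0\cap\big((-c_0,c_0)\times(-c_0,c_0)\big)=\{(x,y):|x|<c_0,\ -c_0<y\le f(x)<c_0\},$$ where $f$ is an even $C^2$ function with $f(0)=f'(0)=0$ and $f''(0)=-\kappa\le0$. Assume $\kappa\ne0$. Let $w^{m,n}(t)$ be the solution of the semi-discrete heat equation with step $h$ and initial data $1$ on lattice points of $\Omega_0$ and $0$ elsewhere (see context). Let $n\ge0$ be an integer. Then for sufficiently small $\tau>0$, $w^{0,-n}(\tau)\le\frac12$ holds if and only if $$\sum_{k=1}^{n-1}\int_0^{\sqrt{\frac{2k}{\mu\kappa}}}e^{-\frac{x^2}{4}}dx+\frac12\int_0^{\sqrt{\frac{2n}{\mu\kappa}}}e^{-\frac{x^2}{4}}dx\ \le\ \frac12\int_{\sqrt{\frac{2n}{\mu\kappa}}}^{\infty}e^{-\frac{x^2}{4}}dx+\sum_{k=n+1}^{\infty}\int_{\sqrt{\frac{2k}{\mu\kappa}}}^{\infty}e^{-\frac{x^2}{4}}dx .$$ In particular, if (for such $\tau$) $w^{0,-n_0}(\tau)=\frac12$ for an integer $n_0\ge 0$, then $$\sum_{k=1}^{n_0-1}\int_0^{\sqrt{\frac{2k}{\mu\kappa}}}e^{-\frac{x^2}{4}}dx+\frac12\int_0^{\sqrt{\frac{2n_0}{\mu\kappa}}}e^{-\frac{x^2}{4}}dx=\frac12\int_{\sqrt{\frac{2n_0}{\mu\kappa}}}^{\infty}e^{-\frac{x^2}{4}}dx+\sum_{k=n_0+1}^{\infty}\int_{\sqrt{\frac{2k}{\mu\kappa}}}^{\infty}e^{-\frac{x^2}{4}}dx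 .$$
   Context: For $h>0$, $\{w^{m,n}(t)\}_{(m,n)\in\mathbb{Z}^2}$, $t\ge0$, is the bounded solution of $$\frac{d}{dt}w^{m,n}=\frac1{h^2}\left[w^{m+1,n}+w^{m-1,n}+w^{m,n+1}+w^{m,n-1}-4w^{m,n}\right],$$ with $w^{m,n}(0)=1$ if $(mh,nh)\in\Omega_0$ and $w^{m,n}(0)=0$ otherwise. The superscripts $(m,n)$ refer to the lattice point $(mh,nh)$. Empty sums are $0$. The number $\kappa$ is the curvature of $\partial\Omega_0$ at the origin.
   Formalization: When the two sides of the displayed inequality are equal, the claim that w^{0,-n}(τ) ≤ 1/2 for all small τ is dropped, since it fails there (w > 1/2 for arbitrarily small τ); the "only if" half and the "in particular" part are kept in full. *)

theory Defs
  imports "HOL-Analysis.Analysis"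
begin

(* Intended for open S, where the iterated deriv only depends on the values of g on S. *)
definition C_k_on :: "nat \<Rightarrow> real set \<Rightarrow> (real \<Rightarrow> real) \<Rightarrow> bool" where
  "C_k_on k S g \<longleftrightarrow>
     (\<forall>j<k. \<forall>x\<in>S. (deriv ^^ j) g field_differentiable at x) \<and>
     continuous_on S ((deriv ^^ k) g)"

definition smooth_on :: "real set \<Rightarrow> (real \<Rightarrow> real) \<Rightarrow> bool" where
  "smooth_on S g \<longleftrightarrow> (\<forall>k. C_k_on k S g)"

(* Near each boundary point p, in suitable orthonormal coordinates (a, b) centred at p, the set
   is the region below the graph of a smooth function.  Which points of the graph belong to the
   set is left open, so the notion does not distinguish open from closed regions. *)
definition smooth_boundary :: "(real \<times> real) set \<Rightarrow> bool" where
  "smooth_boundary \<Omega> \<longleftrightarrow>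
     (\<forall>p\<in>frontier \<Omega>. \<exists>u v r s g.
        norm u = 1 \<and> norm v = 1 \<and> inner u v = 0 \<and> 0 < r \<and> 0 < s \<and>
        smooth_on {-r<..<r} g \<and> g 0 = 0 \<and> (\<forall>a\<in>{-r<..<r}. \<bar>g a\<bar> < s) \<and>
        (\<forall>a\<in>{-r<..<r}. \<forall>b\<in>{-s<..<s}.
           (b < g a \<longrightarrow> p + a *\<^sub>R u + b *\<^sub>R v \<in> \<Omega>) \<and>
           (g a < b \<longrightarrow> p + a *\<^sub>R u + b *\<^sub>R v \<notin> \<Omega>)))"

(* A domain together with some of its boundary points: the regions considered contain the part
   y = f x of their boundary, so they are not open; the domain proper is the interior. *)
definition bounded_smooth_domain :: "(real \<times> real) set \<Rightarrow> bool" where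
  "bounded_smooth_domain \<Omega> \<longleftrightarrow>
     bounded \<Omega> \<and> interior \<Omega> \<noteq> {} \<and> connected (interior \<Omega>) \<and>
     \<Omega> \<subseteq> closure (interior \<Omega>) \<and> smooth_boundary \<Omega>"

(* w m n t is the value at the lattice point (m h, n h) at time t; the derivative at t = 0 is
   one-sided.  Boundedness is uniform in space and time and makes the solution unique. *)
definition semidiscrete_heat_solution ::
  "real \<Rightarrow> (real \<times> real) set \<Rightarrow> (int \<Rightarrow> int \<Rightarrow> real \<Rightarrow> real) \<Rightarrow> bool" where
  "semidiscrete_heat_solution h \<Omega> w \<longleftrightarrow>
     (\<forall>m n. w m n 0 = (if (of_int m * h, of_int n * h) \<in> \<Omega> then 1 else 0)) \<and>
     (\<forall>m n. \<forall>t\<ge>0.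
        (w m n has_real_derivative
           (1 / h^2) * (w (m + 1) n t + w (m - 1) n t + w m (n + 1) t + w m (n - 1) t - 4 * w m n t))
        (at t within {0..})) \<and>
     (\<exists>B. \<forall>m n. \<forall>t\<ge>0. \<bar>w m n t\<bar> \<le> B)"

definition threshold :: "real \<Rightarrow> real \<Rightarrow> nat \<Rightarrow> real" where
  "threshold \<mu> \<kappa> k = sqrt (2 * real k / (\<mu> * \<kappa>))"

definition lower_mass :: "real \<Rightarrow> real \<Rightarrow> nat \<Rightarrow> real" where
  "lower_mass \<mu> \<kappa> k = integral {0..threshold \<mu> \<kappa> k} (\<lambda>x. exp (- (x^2 / 4)))"

definition upper_mass :: "real \<Rightarrow> real \<Rightarrow> nat \<Rightarrow> real" where
  "upper_mass \<mu> \<kappa> k = integral {threshold \<mu> \<kappa> k..} (\<lambda>x. exp (- (x^2 / 4)))"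

(* For n = 0 the truncated subtraction yields the empty range {1..0}, as it should. *)
definition lower_total :: "real \<Rightarrow> real \<Rightarrow> nat \<Rightarrow> real" where
  "lower_total \<mu> \<kappa> n = (\<Sum>k=1..n - 1. lower_mass \<mu> \<kappa> k) + 1/2 * lower_mass \<mu> \<kappa> n"

definition upper_total :: "real \<Rightarrow> real \<Rightarrow> nat \<Rightarrow> real" where
  "upper_total \<mu> \<kappa> n = 1/2 * upper_mass \<mu> \<kappa> n + (\<Sum>\<^sub>\<infinity>k\<in>{n + 1..}. upper_mass \<mu> \<kappa> k)"

end

theory Submission
  imports Defs "HOL-Probability.Probability"
begin

text \<open>With \<open>s = \<tau> / h\<^sup>2 = \<mu> / h\<close>, the bounded solution is \<open>w 0 (- n) \<tau> = P((h X, h (Y - n)) \<in> \<Omega>)\<close> for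
  independent copies \<open>X\<close>, \<open>Y\<close> of the continuous-time simple random walk at time \<open>s\<close>.  Write \<open>p j = P(Y = j)\<close>
  and \<open>A j = P((h X, h (j - n)) \<in> \<Omega>)\<close>.  By symmetry of \<open>Y\<close>,
  \<open>(w - 1/2) / p 0 = (A 0 - 1/2) + (\<Sum>j\<ge>1. p j / p 0 * (A j + A (- j) - 1))\<close>.
  As \<open>h\<close> tends to 0, \<open>p j / p 0\<close> tends to 1, while \<open>- f (h X) / h\<close>, which is about \<open>\<kappa> h X\<^sup>2 / 2\<close>, tends in law
  to \<open>\<mu> \<kappa> Z\<^sup>2\<close> with \<open>Z\<close> standard normal, by the central limit theorem.  Exponential moments of the walk
  bound the \<open>j\<close>-th term by \<open>C / j\<^sup>2\<close>, so Tannery's theorem applies, and the limit equals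
  \<open>(lower_total - upper_total) / sqrt pi\<close>.  Unless it vanishes, its sign decides whether \<open>w\<close> lies above or
  below \<open>1/2\<close>.\<close>

section \<open>The continuous-time simple random walk\<close>

text \<open>The scaling explains why a sum over rows survives in the limit: at diffusive time
  \<open>\<mu> / h\<close> the displacement \<open>h X\<close> has size about
  \<open>sqrt (\<mu> h)\<close>, over which the boundary drops by an amount of order
  \<open>h\<close>, that is, by a random number of rows of order 1. The obstacle is that about
  \<open>sqrt s\<close> rows carry a weight \<open>p j / p 0\<close> of order 1, while
  \<open>A j - 1/2\<close> is close to -1/2 far above the starting row and to 1/2 far below it. Each
  half of the series therefore grows like \<open>sqrt s\<close>; only the paired bracket is summable
  uniformly in \<open>s\<close>. The shape of the region is known only near the origin. Rows and
  columns outside that window must be absorbed by tail bounds alone. The kernel is used in two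
  guises: as a Fourier integral it yields the differential equation and the comparison of
  \<open>p j\<close> with \<open>p 0\<close>, as a distribution it yields tails and the central
  limit theorem.\<close>

lemma measure_pmf_pair:
  fixes p :: "'a::countable pmf" and q :: "'b::countable pmf"
  shows "measure_pmf (pair_pmf p q) = measure_pmf p \<Otimes>\<^sub>M measure_pmf q"
proof (rule pair_measure_eqI[symmetric])
  \<comment> \<open>Countability makes the product sigma-algebra discrete. The identification is
    what later allows Fubini on pairs of Poisson variables.\<close>
  have "sets (measure_pmf p \<Otimes>\<^sub>M measure_pmf q) =
      sets (count_space (UNIV :: 'a set) \<Otimes>\<^sub>M count_space (UNIV :: 'b set))"
    by (intro sets_pair_measure_cong) auto
  then show "sets (measure_pmf p \<Otimes>\<^sub>M measure_pmf q) = sets (measure_pmf (pair_pmf p q))"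
    by (subst (asm) pair_measure_countable) auto
  show "emeasure (measure_pmf p) A * emeasure (measure_pmf q) B =
      emeasure (measure_pmf (pair_pmf p q)) (A \<times> B)" for A B
  proof -
    have "emeasure (measure_pmf (pair_pmf p q)) (A \<times> B) =
        (\<integral>\<^sup>+ x. indicator (A \<times> B) x \<partial>measure_pmf (pair_pmf p q))"
      by simp
    also have "\<dots> = (\<integral>\<^sup>+ a. \<integral>\<^sup>+ b. indicator A a * indicator B b \<partial>measure_pmf q \<partial>measure_pmf p)"
      by (simp add: nn_integral_pair_pmf' indicator_times)
    finally show ?thesis
      by (simp add: nn_integral_cmult nn_integral_multc)
  qed
qed (simp_all add: measure_pmf.sigma_finite_measure_axioms)

lemma expectation_poisson_sums:
  fixes f :: "nat \<Rightarrow> 'a::{banach, second_countable_topology}"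
  assumes "s > 0" and "summable (\<lambda>k. norm ((s ^ k / fact k * exp (- s)) *\<^sub>R f k))"
    and "(\<lambda>k. (s ^ k / fact k * exp (- s)) *\<^sub>R f k) sums S"
  shows "measure_pmf.expectation (poisson_pmf s) f = S"
proof -
  have "integral\<^sup>L (measure_pmf (poisson_pmf s)) f =
      (\<integral>k. (s ^ k / fact k * exp (- s)) *\<^sub>R f k \<partial>count_space UNIV)"
    using assms(1) by (subst measure_pmf_eq_density) (simp add: integral_density)
  also have "\<dots> = S"
    using sums_integral_count_space_nat[of "\<lambda>k. (s ^ k / fact k * exp (- s)) *\<^sub>R f k"] assms
    by (simp add: integrable_count_space_nat_iff sums_unique2)
  finally show ?thesis .
qed

lemma expectation_poisson_exp_i:
  assumes "s > 0"
  shows "measure_pmf.expectation (poisson_pmf s) (\<lambda>k. exp (\<i> * (of_real \<theta> * of_nat k))) =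
    exp (of_real s * (exp (\<i> * of_real \<theta>) - 1))"
proof (rule expectation_poisson_sums[OF assms])
  have eq: "exp (\<i> * (of_real \<theta> * of_nat k)) = exp (\<i> * of_real \<theta>) ^ k" for k
    by (simp add: exp_of_nat_mult[symmetric] mult_ac)
  have "summable (\<lambda>k. (s ^ k / fact k) * exp (- s))"
    using summable_exp[of s] by (intro summable_mult2) (simp add: field_simps)
  then show "summable (\<lambda>k. norm ((s ^ k / fact k * exp (- s)) *\<^sub>R exp (\<i> * (of_real \<theta> * of_nat k))))"
    using assms by (simp add: norm_mult abs_mult)
  have "(\<lambda>k. exp (- of_real s) * ((of_real s * exp (\<i> * of_real \<theta>)) ^ k /\<^sub>R fact k)) sums
      (exp (- of_real s) * exp (of_real s * exp (\<i> * of_real \<theta>)))"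
    by (intro sums_mult exp_converges)
  moreover have "exp (- of_real s) * exp (of_real s * exp (\<i> * of_real \<theta>)) =
      exp (of_real s * (exp (\<i> * of_real \<theta>) - 1))"
    unfolding exp_add[symmetric] by (simp add: algebra_simps)
  moreover have "exp (- of_real s) * ((of_real s * exp (\<i> * of_real \<theta>)) ^ k /\<^sub>R fact k) =
      (s ^ k / fact k * exp (- s)) *\<^sub>R exp (\<i> * (of_real \<theta> * of_nat k))" for k
    unfolding eq by (simp add: scaleR_conv_of_real power_mult_distrib divide_inverse exp_of_real[symmetric])
  ultimately show "(\<lambda>k. (s ^ k / fact k * exp (- s)) *\<^sub>R exp (\<i> * (of_real \<theta> * of_nat k))) sums
      exp (of_real s * (exp (\<i> * of_real \<theta>) - 1))"
    by simp
qed

lemma nn_integral_poisson_exp: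
  assumes "s > 0"
  shows "(\<integral>\<^sup>+ k. ennreal (exp (l * real k)) \<partial>poisson_pmf s) = ennreal (exp (s * (exp l - 1)))"
proof -
  have eq: "exp (l * real k) = exp l ^ k" for k
    by (simp add: exp_of_nat_mult[symmetric] mult_ac)
  have "(\<lambda>k. exp (- s) * ((s * exp l) ^ k /\<^sub>R fact k)) sums (exp (- s) * exp (s * exp l))"
    by (intro sums_mult exp_converges)
  then have "(\<lambda>k. (s ^ k / fact k * exp (- s)) * exp (l * real k)) sums exp (s * (exp l - 1))"
    by (simp add: eq exp_add[symmetric] algebra_simps power_mult_distrib divide_inverse)
  then have "(\<Sum>k. ennreal ((s ^ k / fact k * exp (- s)) * exp (l * real k))) = ennreal (exp (s * (exp l - 1)))"
    using assms by (intro suminf_ennreal_eq) auto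
  moreover have "(\<integral>\<^sup>+ k. ennreal (exp (l * real k)) \<partial>poisson_pmf s) =
      (\<Sum>k. ennreal ((s ^ k / fact k * exp (- s)) * exp (l * real k)))"
    using assms by (simp add: nn_integral_measure_pmf nn_integral_count_space_nat ennreal_mult'[symmetric])
  ultimately show ?thesis by simp
qed

text \<open>A difference of independent Poisson variables is the simple random walk in continuous time
  with jump rate 1 in either direction.\<close>
definition walk :: "real \<Rightarrow> int pmf" where
  "walk s = map_pmf (\<lambda>(a, b). int a - int b) (pair_pmf (poisson_pmf s) (poisson_pmf s))"

lemma walk_uminus: "map_pmf uminus (walk s) = walk s"
  unfolding walk_def
  by (subst (2) pair_commute_pmf) (simp add: pmf.map_comp o_def case_prod_beta)

lemma pmf_walk_uminus: "pmf (walk s) (- j) = pmf (walk s) j"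
  using pmf_map_inj'[of uminus "walk s" j] by (simp add: walk_uminus)

text \<open>The two Poisson factors are conjugate, so the exponents add up to a real number. The
  formula feeds both the Fourier inversion in \<open>heat_kernel_eq_pmf\<close> and the central
  limit theorem.\<close>

lemma expectation_walk_exp_i:
  assumes "s > 0"
  shows "measure_pmf.expectation (walk s) (\<lambda>j. exp (\<i> * (of_real \<theta> * of_int j))) =
    of_real (exp (2 * s * (cos \<theta> - 1)))"
proof -
  interpret pair_sigma_finite "measure_pmf (poisson_pmf s)" "measure_pmf (poisson_pmf s)"
    by (simp add: pair_sigma_finite_def measure_pmf.sigma_finite_measure_axioms)
  let ?e = "\<lambda>a b. exp (\<i> * (of_real \<theta> * of_nat a)) * exp (\<i> * (of_real (- \<theta>) * of_nat b))"
  have int: "integrable (measure_pmf (poisson_pmf s) \<Otimes>\<^sub>M measure_pmf (poisson_pmf s)) (\<lambda>(a, b). ?e a b)"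
    unfolding measure_pmf_pair[symmetric]
    by (rule measure_pmf.integrable_const_bound[where B = 1]) (auto simp: norm_mult)
  have "measure_pmf.expectation (walk s) (\<lambda>j. exp (\<i> * (of_real \<theta> * of_int j))) =
      (\<integral>x. (case x of (a, b) \<Rightarrow> ?e a b) \<partial>measure_pmf (pair_pmf (poisson_pmf s) (poisson_pmf s)))"
    unfolding walk_def by (simp add: case_prod_beta exp_add[symmetric] algebra_simps)
  also have "\<dots> = (\<integral>a. (\<integral>b. ?e a b \<partial>measure_pmf (poisson_pmf s)) \<partial>measure_pmf (poisson_pmf s))"
    unfolding measure_pmf_pair using integral_fst[OF int] by simp
  also have "\<dots> = exp (of_real s * (exp (\<i> * of_real \<theta>) - 1)) * exp (of_real s * (exp (\<i> * of_real (- \<theta>)) - 1))"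
    using expectation_poisson_exp_i[OF assms, of \<theta>] expectation_poisson_exp_i[OF assms, of "- \<theta>"]
    by simp
  also have "\<dots> = exp (of_real s * ((exp (\<i> * of_real \<theta>) + exp (- (\<i> * of_real \<theta>))) - 2))"
    by (simp add: exp_add[symmetric] algebra_simps)
  also have "exp (\<i> * complex_of_real \<theta>) + exp (- (\<i> * of_real \<theta>)) = 2 * of_real (cos \<theta>)"
    by (simp add: cos_of_real[symmetric] cos_exp_eq)
  finally show ?thesis by (simp add: algebra_simps exp_of_real[symmetric])
qed

lemma nn_integral_walk_exp:
  assumes "s > 0"
  shows "(\<integral>\<^sup>+ j. ennreal (exp (l * of_int j)) \<partial>walk s) = ennreal (exp (2 * s * (cosh l - 1)))"
proof -
  have "(\<integral>\<^sup>+ j. ennreal (exp (l * of_int j)) \<partial>walk s) =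
      (\<integral>\<^sup>+ a. \<integral>\<^sup>+ b. ennreal (exp (l * real a)) * ennreal (exp (- l * real b)) \<partial>poisson_pmf s \<partial>poisson_pmf s)"
    unfolding walk_def
    by (simp add: nn_integral_pair_pmf' ennreal_mult'[symmetric] exp_add[symmetric] algebra_simps)
  also have "\<dots> = ennreal (exp (s * (exp l - 1))) * ennreal (exp (s * (exp (- l) - 1)))"
    using nn_integral_poisson_exp[OF assms, of l] nn_integral_poisson_exp[OF assms, of "- l"]
    by (simp add: nn_integral_cmult nn_integral_multc)
  also have "\<dots> = ennreal (exp (2 * s * (cosh l - 1)))"
    by (simp add: ennreal_mult'[symmetric] exp_add[symmetric] algebra_simps cosh_field_def)
  finally show ?thesis .
qed

text \<open>At the scale \<open>l = 1 / sqrt s\<close> the exponential moments stay bounded, since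
  \<open>2 * s * (cosh l - 1)\<close> is at most 2. The sixth power is chosen for
  \<open>tip_term_bound\<close>: division by \<open>heat_kernel s 0\<close> costs at most a further
  factor of order \<open>s\<close>, and \<open>s ^ 4 / j ^ 6\<close> is of order
  \<open>1 / j ^ 2\<close> when \<open>s\<close> is at most a multiple of \<open>j\<close>.\<close>

lemma walk_tail:
  assumes "s \<ge> 1" "a > 0"
  shows "measure (walk s) {j. a \<le> \<bar>of_int j\<bar>} \<le> 1440 * exp 2 * (s / a\<^sup>2) ^ 3"
proof -
  define l where "l = 1 / sqrt s"
  have s: "s > 0" and l: "0 < l" "l \<le> 1" "s * l\<^sup>2 = 1" using assms by (auto simp: l_def power_divide)
  define f where "f j = exp (l * of_int j) + exp (- l * of_int j)" for j :: int
  have "cosh l \<le> 1 + l\<^sup>2"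
  proof -
    have "exp l \<le> 1 + l + l\<^sup>2" using l by (intro exp_bound) auto
    moreover have "exp (- l) \<le> 1 - l + l\<^sup>2"
    proof -
      \<comment> \<open>The product equals \<open>1 + l ^ 3\<close>.\<close>
      have "1 \<le> (1 + l) * (1 - l + l\<^sup>2)" using l by (simp add: algebra_simps power2_eq_square)
      then have "1 / (1 + l) \<le> 1 - l + l\<^sup>2" using l by (simp add: field_simps)
      moreover have "exp (- l) \<le> 1 / (1 + l)"
        using l exp_ge_add_one_self[of l] by (simp add: exp_minus divide_inverse le_imp_inverse_le)
      ultimately show ?thesis by linarith
    qed
    ultimately show ?thesis by (simp add: cosh_field_def)
  qed
  then have "s * (cosh l - 1) \<le> s * l\<^sup>2" using s by (intro mult_left_mono) auto
  then have "2 * s * (cosh l - 1) \<le> 2" using l by simp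
  moreover have "(\<integral>\<^sup>+ j. ennreal (f j) \<partial>walk s) = ennreal (2 * exp (2 * s * (cosh l - 1)))"
    using nn_integral_walk_exp[OF s, of l] nn_integral_walk_exp[OF s, of "- l"]
    unfolding f_def by (simp add: nn_integral_add ennreal_mult flip: mult_2)
  ultimately have I: "(\<integral>\<^sup>+ j. ennreal (f j) \<partial>walk s) \<le> ennreal (2 * exp 2)"
    by (simp add: ennreal_leI)
  \<comment> \<open>One term of the exponential series, with 720 = 6!. The constant 1440 is 720
    times the 2 from the two exponentials in \<open>f\<close>; Markov's inequality for
    \<open>f\<close> finishes the proof.\<close>
  have pow: "x ^ 6 / 720 \<le> exp x + exp (- x)" for x :: real
  proof -
    have *: "x ^ 6 / 720 \<le> exp x" if "x \<ge> 0" for x :: real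
      using sum_le_suminf[OF sums_summable[OF exp_converges[of x]], of "{6}"] that
        sums_unique[OF exp_converges[of x]] by (simp add: fact_numeral field_simps)
    show ?thesis
      using *[of x] *[of "- x"] by (cases "x \<ge> 0") (auto intro: order.trans add_increasing add_increasing2)
  qed
  define c where "c = (l * a) ^ 6 / 720"
  have c: "c > 0" using l assms by (simp add: c_def)
  have "emeasure (walk s) {j. a \<le> \<bar>of_int j\<bar>} = (\<integral>\<^sup>+ j. indicator {j. a \<le> \<bar>of_int j\<bar>} j \<partial>walk s)"
    by simp
  also have "\<dots> \<le> (\<integral>\<^sup>+ j. ennreal (1/c) * ennreal (f j) \<partial>walk s)"
  proof (intro nn_integral_mono)
    fix j :: int
    have "1 \<le> (1 / c) * f j" if "a \<le> \<bar>of_int j\<bar>"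
    proof -
      have "c \<le> (l * \<bar>of_int j\<bar>) ^ 6 / 720" unfolding c_def using that l assms
        by (intro divide_right_mono power_mono) auto
      also have "\<dots> = (l * of_int j) ^ 6 / 720" by (simp add: power_mult_distrib power_even_abs)
      also have "\<dots> \<le> f j" unfolding f_def using pow[of "l * of_int j"] by simp
      finally show ?thesis using c by simp
    qed
    moreover have "f j \<ge> 0" by (simp add: f_def)
    ultimately show "indicator {j. a \<le> \<bar>of_int j\<bar>} j \<le> ennreal (1/c) * ennreal (f j)"
      using c by (auto simp: ennreal_mult'[symmetric] indicator_def simp del: times_divide_eq_left)
  qed
  also have "\<dots> = ennreal (1/c) * (\<integral>\<^sup>+ j. ennreal (f j) \<partial>walk s)" by (simp add: nn_integral_cmult)
  also have "\<dots> \<le> ennreal (1/c) * ennreal (2 * exp 2)" by (intro mult_left_mono I) auto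
  also have "\<dots> = ennreal (1440 * exp 2 * (s / a\<^sup>2) ^ 3)"
  proof -
    have "(l * a) ^ 6 = (a\<^sup>2 / s) ^ 3"
      using s power_mult[of "sqrt s" 2 3] by (simp add: l_def power_divide power_mult_distrib)
    then show ?thesis using c unfolding c_def by (simp add: ennreal_mult'[symmetric] field_simps power_divide)
  qed
  finally show ?thesis
    using s assms by (simp add: measure_pmf.emeasure_eq_measure)
qed

section \<open>The lattice heat kernel as a Fourier integral\<close>

text \<open>In terms of the modified Bessel function this is
  \<open>exp (- 2 * s) * I_j (2 * s)\<close>. The integral makes sense for every real
  \<open>s\<close>, including the initial time 0, and can be differentiated in \<open>s\<close>
  under the integral sign.\<close>

definition heat_kernel :: "real \<Rightarrow> int \<Rightarrow> real" where
  "heat_kernel s j = integral {-pi..pi} (\<lambda>t. exp (2 * s * (cos t - 1)) * cos (of_int j * t)) / (2 * pi)"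

lemma heat_kernel_integrable:
  "(\<lambda>t. exp (2 * s * (cos t - 1)) * cos (of_int j * t)) integrable_on {a..b::real}"
  by (intro integrable_continuous_real continuous_intros)

lemma has_real_derivative_heat_kernel:
  "((\<lambda>s. heat_kernel s j) has_real_derivative
     heat_kernel s (j + 1) + heat_kernel s (j - 1) - 2 * heat_kernel s j) (at s within S)"
proof -
  let ?f = "\<lambda>j s t. exp (2 * s * (cos t - 1)) * cos (of_int j * t)"
  let ?f' = "\<lambda>s t. exp (2 * s * (cos t - 1)) * (2 * (cos t - 1)) * cos (of_int j * t)"
  have "((\<lambda>s. integral (cbox (-pi) pi) (?f j s)) has_field_derivative
      integral (cbox (-pi) pi) (?f' s)) (at s within UNIV)"
    by (rule leibniz_rule_field_derivative)
      (auto intro!: derivative_eq_intros continuous_intros integrable_continuous_real simp: case_prod_beta)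
  moreover have "?f' s = (\<lambda>t. ?f (j + 1) s t + ?f (j - 1) s t - 2 * ?f j s t)"
    by (rule ext) (simp add: algebra_simps cos_add cos_diff)
  then have "integral {-pi..pi} (?f' s) =
      integral {-pi..pi} (?f (j + 1) s) + integral {-pi..pi} (?f (j - 1) s) - 2 * integral {-pi..pi} (?f j s)"
    using heat_kernel_integrable
    by (simp add: integral_add integral_diff integrable_add integrable_on_cmult_left del: of_int_add of_int_diff)
  ultimately have "((\<lambda>s. integral {-pi..pi} (?f j s)) has_field_derivative
      integral {-pi..pi} (?f (j + 1) s) + integral {-pi..pi} (?f (j - 1) s) - 2 * integral {-pi..pi} (?f j s)) (at s within S)"
    using has_field_derivative_at_within by auto
  from DERIV_cdivide[OF this, of "2 * pi"] show ?thesis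
    unfolding heat_kernel_def by (simp add: add_divide_distrib diff_divide_distrib)
qed

lemma has_integral_cos_int:
  "((\<lambda>t. cos (of_int j * t)) has_integral (if j = 0 then 2 * pi else 0)) {-pi..pi}"
proof (cases "j = 0")
  case True
  then show ?thesis using has_integral_const_real[of "1::real" "-pi" pi] by (simp add: mult.commute)
next
  case False
  have "((\<lambda>t. cos (of_int j * t)) has_integral sin (of_int j * pi) / of_int j - sin (of_int j * (- pi)) / of_int j) {-pi..pi}"
    using False
    by (intro fundamental_theorem_of_calculus)
      (auto intro!: derivative_eq_intros simp flip: has_real_derivative_iff_has_vector_derivative)
  moreover have "sin (of_int j * pi) = 0" by (subst sin_zero_iff_int2) auto
  ultimately show ?thesis using False by simp
qed

lemma heat_kernel_0: "heat_kernel 0 j = (if j = 0 then 1 else 0)"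
  using integral_unique[OF has_integral_cos_int[of j]] by (simp add: heat_kernel_def)

text \<open>Fourier inversion: the weight \<open>exp (2 * s * (cos t - 1))\<close> is the
  characteristic function of the walk. After Fubini, orthogonality of the cosines leaves only the
  states \<open>j\<close> and \<open>- j\<close>.\<close>

lemma heat_kernel_eq_pmf:
  assumes "s > 0"
  shows "heat_kernel s j = pmf (walk s) j"
proof -
  let ?L = "restrict_space lborel {-pi..pi} :: real measure"
  have fin: "finite_measure ?L"
    by (rule finite_measureI) (simp add: emeasure_restrict_space space_restrict_space)
  interpret pair_sigma_finite "measure_pmf (walk s)" ?L
    by (simp add: pair_sigma_finite_def measure_pmf.sigma_finite_measure_axioms
        finite_measure.axioms(1)[OF fin])
  interpret P: finite_measure "measure_pmf (walk s) \<Otimes>\<^sub>M ?L"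
    by (intro finite_measure_pair_measure fin measure_pmf.finite_measure_axioms)
  let ?g = "\<lambda>i t::real. cos (of_int i * t) * cos (of_int j * t)"
  have "(\<lambda>(i, t). ?g i t) \<in> borel_measurable (count_space UNIV \<Otimes>\<^sub>M ?L)"
    by (rule measurable_pair_measure_countable1) (auto intro!: measurable_restrict_space1)
  then have "(\<lambda>(i, t). ?g i t) \<in> borel_measurable (measure_pmf (walk s) \<Otimes>\<^sub>M ?L)"
    by (subst measurable_cong_sets[OF sets_pair_measure_cong refl]) auto
  then have int: "integrable (measure_pmf (walk s) \<Otimes>\<^sub>M ?L) (\<lambda>(i, t). ?g i t)"
    by (rule P.integrable_const_bound[where B = 1, rotated]) (auto intro!: AE_I2 mult_le_one simp: abs_mult)
  have L: "integral\<^sup>L ?L h = integral {-pi..pi} h" if "continuous_on {-pi..pi} h" for h :: "real \<Rightarrow> real"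
  proof -
    have "set_integrable lborel {-pi..pi} h"
      using that by (intro borel_integrable_compact[folded set_integrable_def]) auto
    from set_borel_integral_eq_integral(2)[OF this] show ?thesis
      by (simp add: integral_restrict_space set_lebesgue_integral_def)
  qed
  have E: "measure_pmf.expectation (walk s) (\<lambda>i. cos (t * of_int i)) = exp (2 * s * (cos t - 1))" for t
  proof -
    have "integrable (walk s) (\<lambda>j. exp (\<i> * (complex_of_real t * of_int j)))"
      by (rule measure_pmf.integrable_const_bound[where B = 1]) (auto simp: norm_mult)
    from integral_Re[OF this] show ?thesis
      unfolding expectation_walk_exp_i[OF assms] by (simp add: Re_exp)
  qed
  have "integral {-pi..pi} (\<lambda>t. exp (2 * s * (cos t - 1)) * cos (of_int j * t)) =
      (\<integral>t. (\<integral>i. ?g i t \<partial>walk s) \<partial>?L)"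
    unfolding Bochner_Integration.integral_mult_left_zero
    by (subst L[symmetric]) (auto intro!: continuous_intros simp: E mult.commute[of "of_int _" t for t])
  also have "\<dots> = (\<integral>i. (\<integral>t. ?g i t \<partial>?L) \<partial>walk s)"
    by (rule Fubini_integral[OF int])
  \<comment> \<open>For \<open>j = 0\<close> the two indicators coincide and give the full
    \<open>2 * pi\<close>; otherwise the symmetry of the walk merges the two halves.\<close>
  also have "\<dots> = (\<integral>i. pi * indicator {j} i + pi * indicator {- j} i \<partial>walk s)"
  proof (intro Bochner_Integration.integral_cong refl)
    fix i :: int
    have "?g i = (\<lambda>t. (cos (of_int (i + j) * t) + cos (of_int (i - j) * t)) / 2)"
      by (rule ext) (simp add: algebra_simps cos_add cos_diff)
    then have "(?g i has_integral ((if i + j = 0 then 2 * pi else 0) + (if i - j = 0 then 2 * pi else 0)) / 2) {-pi..pi}"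
      using has_integral_divide[OF has_integral_add[OF has_integral_cos_int[of "i + j"] has_integral_cos_int[of "i - j"]], of 2]
      by (simp only:)
    moreover have "integral\<^sup>L ?L (?g i) = integral {-pi..pi} (?g i)"
      by (rule L) (intro continuous_intros)
    ultimately show "(\<integral>t. ?g i t \<partial>?L) = pi * indicator {j} i + pi * indicator {- j} i"
      by (auto simp: indicator_def dest!: integral_unique)
  qed
  also have "\<dots> = 2 * pi * pmf (walk s) j"
    by (subst Bochner_Integration.integral_add) (auto simp: measure_pmf_single pmf_walk_uminus measure_pmf.emeasure_eq_measure)
  finally show ?thesis by (simp add: heat_kernel_def)
qed

lemma heat_kernel_le_0: "heat_kernel s j \<le> heat_kernel s 0"
proof -
  have "integral {-pi..pi} (\<lambda>t. exp (2 * s * (cos t - 1)) * cos (of_int j * t)) \<le>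
      integral {-pi..pi} (\<lambda>t. exp (2 * s * (cos t - 1)) * cos (of_int 0 * t))"
    by (intro integral_le heat_kernel_integrable) (auto intro!: mult_left_le)
  then show ?thesis by (simp add: heat_kernel_def divide_right_mono)
qed

lemma one_minus_cos_le: "1 - cos (x::real) \<le> x\<^sup>2 / 2"
proof -
  have "1 - cos x = 2 * (sin (x / 2))\<^sup>2"
    using cos_double_sin[of "x / 2"] by simp
  moreover have "(sin (x / 2))\<^sup>2 \<le> (x / 2)\<^sup>2"
    using abs_sin_x_le_abs_x[of "x / 2"] by (simp only: abs_le_square_iff)
  ultimately show ?thesis by (simp add: power_divide)
qed

text \<open>The integral is cut down to \<open>\<bar>t\<bar> \<le> 1 / sqrt s\<close>, where the
  exponent is at least \<open>- s * t^2\<close>, hence at least -1.\<close>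

lemma heat_kernel_0_ge:
  assumes "s \<ge> 1"
  shows "heat_kernel s 0 \<ge> exp (- 1) / (pi * sqrt s)"
proof -
  let ?f = "\<lambda>t. exp (2 * s * (cos t - 1)) * cos (of_int 0 * t)"
  define a where "a = 1 / sqrt s"
  have "sqrt s \<ge> 1" using assms by simp
  then have "a \<le> 1" "0 < a" by (auto simp: a_def)
  moreover have "a\<^sup>2 = 1 / s" using assms by (simp add: a_def power_divide)
  ultimately have a: "0 < a" "a \<le> pi" "s * a\<^sup>2 = 1" using pi_ge_two assms by auto
  have "exp (- 1) * (2 * a) = integral {-a..a} (\<lambda>t. exp (- 1))" using a by simp
  also have "\<dots> \<le> integral {-a..a} ?f"
  proof (intro integral_le heat_kernel_integrable)
    fix t assume "t \<in> {-a..a}"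
    then have "t\<^sup>2 \<le> a\<^sup>2" using a by (intro abs_le_square_iff[THEN iffD1]) auto
    then have "s * t\<^sup>2 \<le> s * a\<^sup>2" using assms by (intro mult_left_mono) auto
    moreover have "s * (1 - cos t) \<le> s * (t\<^sup>2 / 2)" using assms by (intro mult_left_mono one_minus_cos_le) auto
    ultimately have "- 1 \<le> 2 * s * (cos t - 1)" using a by (simp add: algebra_simps)
    then show "exp (- 1) \<le> ?f t" by simp
  qed auto
  also have "\<dots> \<le> integral {-pi..pi} ?f"
    using a by (intro integral_subset_le heat_kernel_integrable) auto
  finally show ?thesis using assms unfolding heat_kernel_def a_def by (simp add: field_simps)
qed

lemma abs_sin_of_nat_mult_le: "\<bar>sin (of_nat n * x)\<bar> \<le> of_nat n * \<bar>sin (x::real)\<bar>"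
proof (induction n)
  case (Suc n)
  have "\<bar>sin (of_nat (Suc n) * x)\<bar> \<le> \<bar>sin (of_nat n * x) * cos x\<bar> + \<bar>cos (of_nat n * x) * sin x\<bar>"
    by (simp add: algebra_simps sin_add abs_triangle_ineq)
  also have "\<dots> \<le> \<bar>sin (of_nat n * x)\<bar> * 1 + 1 * \<bar>sin x\<bar>"
    unfolding abs_mult by (intro add_mono mult_mono) auto
  finally show ?case using Suc by (simp add: algebra_simps)
qed simp

text \<open>By the half-angle formula this is the square of \<open>abs_sin_of_nat_mult_le\<close>.
  It compares all frequencies with the single quantity \<open>1 - cos t\<close> that governs the
  weight of the kernel.\<close>

lemma one_minus_cos_mult_le: "1 - cos (of_int j * t) \<le> (of_int j)\<^sup>2 * (1 - cos (t::real))"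
proof -
  have eq: "1 - cos x = 2 * (sin (x / 2))\<^sup>2" for x :: real
    using cos_double_sin[of "x / 2"] by simp
  have "\<bar>sin (of_int j * (t / 2))\<bar> = \<bar>sin (of_nat (nat \<bar>j\<bar>) * (t / 2))\<bar>"
    by (cases "j \<ge> 0") auto
  also have "\<dots> \<le> of_nat (nat \<bar>j\<bar>) * \<bar>sin (t / 2)\<bar>"
    by (rule abs_sin_of_nat_mult_le)
  finally have "\<bar>sin (of_int j * (t / 2))\<bar> \<le> \<bar>of_int j * sin (t / 2)\<bar>"
    by (simp add: abs_mult)
  then have "(sin (of_int j * (t / 2)))\<^sup>2 \<le> (of_int j * sin (t / 2))\<^sup>2"
    by (simp only: abs_le_square_iff)
  then show ?thesis by (simp add: eq power_mult_distrib)
qed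

text \<open>With \<open>u = 1 - cos t\<close>, the mass of \<open>exp (- 2 s u)\<close> concentrates on \<open>u < 1 / sqrt s\<close>,
  where \<open>1 - cos (j t) \<le> j\<^sup>2 u\<close> is small.\<close>
lemma heat_kernel_0_diff_le:
  assumes "s \<ge> 1"
  shows "heat_kernel s 0 - heat_kernel s j \<le> (of_int j)\<^sup>2 * (heat_kernel s 0 / sqrt s + 1 / s)"
proof -
  let ?f = "\<lambda>j t. exp (2 * s * (cos t - 1)) * cos (of_int j * t)"
  have "integral {-pi..pi} (?f 0) - integral {-pi..pi} (?f j) = integral {-pi..pi} (\<lambda>t. ?f 0 t - ?f j t)"
    by (intro integral_diff[symmetric] heat_kernel_integrable)
  also have "\<dots> \<le> integral {-pi..pi} (\<lambda>t. (of_int j)\<^sup>2 * (?f 0 t / sqrt s + 1 / s))"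
  proof (intro integral_le integrable_diff heat_kernel_integrable)
    show "(\<lambda>t. (of_int j)\<^sup>2 * (?f 0 t / sqrt s + 1 / s)) integrable_on {-pi..pi}"
      using assms by (intro integrable_continuous_real continuous_intros) auto
    fix t :: real
    define u where "u = 1 - cos t"
    have u: "0 \<le> u" "u \<le> 2" using cos_ge_minus_one[of t] by (auto simp: u_def simp del: cos_ge_minus_one)
    have "exp (- (2 * s * u)) * u \<le> exp (- (2 * s * u)) / sqrt s + 1 / s"
    proof (cases "u \<le> 1 / sqrt s")
      case True
      then have "exp (- (2 * s * u)) * u \<le> exp (- (2 * s * u)) * (1 / sqrt s)"
        by (intro mult_left_mono) auto
      then show ?thesis using assms by (simp add: add_increasing2)
    next
      case False
      then have "s * (1 / sqrt s) \<le> s * u" using assms by (intro mult_left_mono) auto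
      then have le: "2 * sqrt s \<le> 2 * s * u" using assms by (simp add: real_div_sqrt)
      \<comment> \<open>The quadratic Taylor term of the exponential alone gives
        \<open>exp (2 * s * u) \<ge> 2 * s\<close>; with \<open>u \<le> 2\<close> this produces the
        error \<open>1 / s\<close>.\<close>
      have "(2 * sqrt s)\<^sup>2 / 2 \<le> 1 + 2 * sqrt s + (2 * sqrt s)\<^sup>2 / 2" using assms by simp
      also have "\<dots> \<le> exp (2 * sqrt s)"
        using exp_lower_Taylor_quadratic[of "2 * sqrt s"] assms by simp
      also have "\<dots> \<le> exp (2 * s * u)" using le by simp
      finally have "2 * s \<le> exp (2 * s * u)" using assms by (simp add: power_mult_distrib)
      then have "exp (- (2 * s * u)) \<le> 1 / (2 * s)"
        using assms by (simp add: exp_minus field_simps)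
      then have "exp (- (2 * s * u)) * u \<le> 1 / (2 * s) * 2"
        using u assms by (intro mult_mono) auto
      then show ?thesis using assms by (simp add: add_increasing)
    qed
    moreover have "exp (- (2 * s * u)) * (1 - cos (of_int j * t)) \<le> exp (- (2 * s * u)) * ((of_int j)\<^sup>2 * u)"
      unfolding u_def by (intro mult_left_mono one_minus_cos_mult_le) auto
    ultimately have "exp (- (2 * s * u)) * (1 - cos (of_int j * t)) \<le>
        (of_int j)\<^sup>2 * (exp (- (2 * s * u)) / sqrt s + 1 / s)"
      using mult_left_mono[of "exp (- (2 * s * u)) * u" _ "(of_int j)\<^sup>2"]
      by (smt (verit, best) mult.assoc mult.commute zero_le_power2)
    moreover have "- (2 * s * u) = 2 * s * (cos t - 1)" by (simp add: u_def algebra_simps)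
    ultimately show "?f 0 t - ?f j t \<le> (of_int j)\<^sup>2 * (?f 0 t / sqrt s + 1 / s)"
      by (simp add: right_diff_distrib)
  qed
  also have "\<dots> = (of_int j)\<^sup>2 * (integral {-pi..pi} (?f 0) / sqrt s + 2 * pi / s)"
    using heat_kernel_integrable[of s 0 "-pi" pi]
    by (subst integral_mult_right, subst integral_add) (auto intro!: integrable_on_divide)
  finally show ?thesis unfolding heat_kernel_def by (simp add: field_simps)
qed

text \<open>Since \<open>heat_kernel s 0\<close> is at least of order \<open>1 / sqrt s\<close>,
  both errors in \<open>heat_kernel_0_diff_le\<close> are of order \<open>1 / sqrt s\<close>
  relative to it. The limit is for fixed \<open>j\<close>; control that is uniform in
  \<open>j\<close> comes from \<open>tip_term_bound\<close>.\<close>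

lemma heat_kernel_ratio_tendsto: "((\<lambda>s. heat_kernel s j / heat_kernel s 0) \<longlongrightarrow> 1) at_top"
proof (rule tendsto_sandwich)
  let ?g = "\<lambda>s. 1 - (of_int j)\<^sup>2 * ((1 + pi * exp 1) * inverse (sqrt s))"
  show "(?g \<longlongrightarrow> 1) at_top"
    by (rule tendsto_eq_intros tendsto_inverse_0_at_top sqrt_at_top refl | simp)+
  show "\<forall>\<^sub>F s in at_top. heat_kernel s j / heat_kernel s 0 \<le> 1"
    using eventually_ge_at_top[of 1]
  proof eventually_elim
    case (elim s)
    have "0 < exp (- 1) / (pi * sqrt s)" using elim by simp
    then have "0 < heat_kernel s 0" using heat_kernel_0_ge[OF elim] by linarith
    then show ?case using heat_kernel_le_0[of s j] by simp
  qed
  show "\<forall>\<^sub>F s in at_top. ?g s \<le> heat_kernel s j / heat_kernel s 0"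
    using eventually_ge_at_top[of 1]
  proof eventually_elim
    case (elim s)
    have "0 < exp (- 1) / (pi * sqrt s)" using elim by simp
    then have pos: "0 < heat_kernel s 0" using heat_kernel_0_ge[OF elim] by linarith
    have "1 \<le> heat_kernel s 0 * (pi * exp 1 * sqrt s)"
      using heat_kernel_0_ge[OF elim] elim by (simp add: exp_minus field_simps)
    then have "1 / s \<le> heat_kernel s 0 * (pi * exp 1 * sqrt s) / s"
      using elim by (intro divide_right_mono) auto
    also have "\<dots> = heat_kernel s 0 * (pi * exp 1 * inverse (sqrt s))"
      using elim by (simp add: field_simps)
    finally have "(of_int j)\<^sup>2 * (heat_kernel s 0 / sqrt s + 1 / s) \<le>
        (of_int j)\<^sup>2 * (heat_kernel s 0 / sqrt s + heat_kernel s 0 * (pi * exp 1 * inverse (sqrt s)))"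
      by (intro mult_left_mono add_left_mono) auto
    with heat_kernel_0_diff_le[OF elim, of j] 
    have "heat_kernel s 0 - heat_kernel s j \<le> (of_int j)\<^sup>2 * ((1 + pi * exp 1) * inverse (sqrt s)) * heat_kernel s 0"
      by (simp add: algebra_simps divide_inverse)
    then show ?case using pos by (simp add: pos_le_divide_eq left_diff_distrib)
  qed
qed simp

section \<open>Bounded solutions of the semi-discrete heat equation\<close>

lemma heat_kernel_bounds:
  assumes "s \<ge> 0"
  shows "0 \<le> heat_kernel s j" "heat_kernel s j \<le> 1"
  using assms heat_kernel_eq_pmf[of s j] heat_kernel_0[of j]
  by (cases "s = 0"; simp add: pmf_le_1)+

text \<open>Integrating the equation \<open>k\<close> times improves the bound \<open>B\<close> to \<open>B (8 c t)\<^sup>k / k!\<close>.\<close>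
lemma bounded_semidiscrete_heat_zero:
  fixes u :: "int \<Rightarrow> int \<Rightarrow> real \<Rightarrow> real"
  assumes "c \<ge> 0"
    and deriv: "\<And>m n t. t \<ge> 0 \<Longrightarrow> (u m n has_real_derivative
      c * (u (m + 1) n t + u (m - 1) n t + u m (n + 1) t + u m (n - 1) t - 4 * u m n t)) (at t within {0..})"
    and bound: "\<And>m n t. t \<ge> 0 \<Longrightarrow> \<bar>u m n t\<bar> \<le> B"
    and zero: "\<And>m n. u m n 0 = 0"
    and "t \<ge> 0"
  shows "u m n t = 0"
proof -
  have le: "\<bar>u m n t\<bar> \<le> B * (8 * c * t) ^ k / fact k" if "t \<ge> 0" for m n t k
    using that
  proof (induction k arbitrary: m n t)
    case 0
    then show ?case using bound by simp
  next
    case (Suc k)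
    show ?case
    proof (cases "t = 0")
      case True
      then show ?thesis using zero by simp
    next
      case False
      \<comment> \<open>A primitive of \<open>8 * c\<close> times the inductive bound; 8 counts the
        four neighbours plus the coefficient 4 of the centre.\<close>
      define \<phi> where "\<phi> x = B * (8 * c * x) ^ Suc k / fact (Suc k)" for x
      have "norm (u m n t - u m n 0) \<le> \<phi> t - \<phi> 0"
      proof (rule differentiable_bound_general)
        show "0 < t" using False Suc.prems by simp
        show "continuous_on {0..t} (u m n)"
        proof (rule continuous_on_subset[of "{0..}"])
          show "continuous_on {0..} (u m n)"
            using deriv by (intro DERIV_continuous_on) auto
        qed auto
        show "continuous_on {0..t} \<phi>" unfolding \<phi>_def by (intro continuous_intros) auto
        fix x assume x: "0 < x" "x < t"
        show "(u m n has_vector_derivative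
            c * (u (m + 1) n x + u (m - 1) n x + u m (n + 1) x + u m (n - 1) x - 4 * u m n x)) (at x)"
          using deriv[of x m n] x at_within_interior[of x "{0..}"]
          by (simp add: has_real_derivative_iff_has_vector_derivative interior_real_atLeast)
        have "(\<phi> has_real_derivative B * (real (Suc k) * ((8 * c * x) ^ k * (8 * c))) / fact (Suc k)) (at x)"
          unfolding \<phi>_def
          by (intro DERIV_cdivide DERIV_cmult DERIV_cong[OF DERIV_power[where f = "\<lambda>x. 8 * c * x" and n = "Suc k", OF DERIV_cmult_Id]])
            (simp add: mult_ac)
        also have "B * (real (Suc k) * ((8 * c * x) ^ k * (8 * c))) / fact (Suc k) = 8 * c * (B * (8 * c * x) ^ k / fact k)"
          by (simp add: field_simps del: of_nat_Suc)
        finally show "(\<phi> has_vector_derivative 8 * c * (B * (8 * c * x) ^ k / fact k)) (at x)"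
          by (simp add: has_real_derivative_iff_has_vector_derivative)
        let ?b = "B * (8 * c * x) ^ k / fact k"
        have IH: "\<bar>u m n x\<bar> \<le> ?b" for m n using Suc.IH x by simp
        have "\<bar>u (m + 1) n x + u (m - 1) n x + u m (n + 1) x + u m (n - 1) x - 4 * u m n x\<bar> \<le> 8 * ?b"
          using IH[of "m + 1" n] IH[of "m - 1" n] IH[of m "n + 1"] IH[of m "n - 1"] IH[of m n] by linarith
        from mult_left_mono[OF this assms(1)]
        show "norm (c * (u (m + 1) n x + u (m - 1) n x + u m (n + 1) x + u m (n - 1) x - 4 * u m n x)) \<le> 8 * c * ?b"
          using assms(1) by (simp only: real_norm_def abs_mult abs_of_nonneg mult.assoc mult.left_commute[of 8 c])
      qed
      then show ?thesis by (simp add: zero \<phi>_def)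
    qed
  qed
  have "(\<lambda>k. B * ((8 * c * t) ^ k /\<^sub>R fact k)) \<longlonglongrightarrow> B * 0"
    by (intro tendsto_mult tendsto_const summable_LIMSEQ_zero sums_summable[OF exp_converges])
  then have "\<bar>u m n t\<bar> \<le> B * 0"
    by (rule tendsto_lowerbound) (use le[OF \<open>t \<ge> 0\<close>] in \<open>simp_all add: divide_inverse mult_ac\<close>)
  then show ?thesis by simp
qed

lemma finite_lattice_points:
  assumes "bounded \<Omega>" "h > (0::real)"
  shows "finite {(i, j). (of_int i * h, of_int j * h) \<in> \<Omega>}"
proof -
  from assms(1) obtain R where R: "\<And>z. z \<in> \<Omega> \<Longrightarrow> norm z \<le> R" by (auto simp: bounded_iff)
  define N where "N = \<lceil>R / h\<rceil>"
  have *: "i \<in> {-N..N}" if "\<bar>of_int i * h\<bar> \<le> R" for i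
  proof -
    have "\<bar>of_int i\<bar> \<le> R / h" using that assms(2) by (simp add: abs_mult field_simps)
    also have "\<dots> \<le> of_int N" by (simp add: N_def)
    finally show ?thesis by (simp add: abs_le_iff)
  qed
  have "(i, j) \<in> {-N..N} \<times> {-N..N}" if "(of_int i * h, of_int j * h) \<in> \<Omega>" for i j
    using *[of i] *[of j] norm_fst_le[of "of_int i * h" "of_int j * h"] norm_snd_le[of "of_int j * h" "of_int i * h"] R[OF that]
    by (auto simp: mem_Times_iff)
  then show ?thesis by (intro finite_subset[OF _ finite_cartesian_product[of "{-N..N}" "{-N..N}"]]) auto
qed

text \<open>Products of one-dimensional kernels solve the planar equation and start as point masses.
  Boundedness of the region makes the superposition a finite sum, so it is differentiated termwise
  and bounded by the number of terms; uniqueness of bounded solutions does the rest.\<close>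

lemma semidiscrete_heat_solution_eq:
  assumes "semidiscrete_heat_solution h \<Omega> w" "bounded \<Omega>" "h > 0" "t \<ge> 0"
  shows "w m n t = (\<Sum>(i, j) | (of_int i * h, of_int j * h) \<in> \<Omega>.
    heat_kernel (t / h\<^sup>2) (i - m) * heat_kernel (t / h\<^sup>2) (j - n))"
proof -
  define \<Lambda> where "\<Lambda> = {(i, j). (of_int i * h, of_int j * h) \<in> \<Omega>}"
  define v where "v m n t = (\<Sum>(i, j)\<in>\<Lambda>. heat_kernel (t / h\<^sup>2) (i - m) * heat_kernel (t / h\<^sup>2) (j - n))" for m n t
  have fin: "finite \<Lambda>" unfolding \<Lambda>_def by (rule finite_lattice_points[OF assms(2,3)])
  have K: "((\<lambda>t. heat_kernel (t / h\<^sup>2) j) has_real_derivative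
      (heat_kernel (t / h\<^sup>2) (j + 1) + heat_kernel (t / h\<^sup>2) (j - 1) - 2 * heat_kernel (t / h\<^sup>2) j) * (1 / h\<^sup>2))
      (at t within S)" for t j S
    by (rule DERIV_chain2[OF has_real_derivative_heat_kernel DERIV_cdivide[OF DERIV_ident]])
  obtain B where B: "\<And>m n t. t \<ge> 0 \<Longrightarrow> \<bar>w m n t\<bar> \<le> B"
    using assms(1) unfolding semidiscrete_heat_solution_def by blast
  have "w m n t - v m n t = 0"
  proof (rule bounded_semidiscrete_heat_zero[where u = "\<lambda>m n t. w m n t - v m n t" and c = "1 / h\<^sup>2"])
    fix m n :: int and t :: real assume t: "t \<ge> 0"
    have "(v m n has_real_derivative (\<Sum>(i, j)\<in>\<Lambda>.
        (heat_kernel (t / h\<^sup>2) (i - m + 1) + heat_kernel (t / h\<^sup>2) (i - m - 1) - 2 * heat_kernel (t / h\<^sup>2) (i - m)) * (1 / h\<^sup>2) * heat_kernel (t / h\<^sup>2) (j - n) +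
        (heat_kernel (t / h\<^sup>2) (j - n + 1) + heat_kernel (t / h\<^sup>2) (j - n - 1) - 2 * heat_kernel (t / h\<^sup>2) (j - n)) * (1 / h\<^sup>2) * heat_kernel (t / h\<^sup>2) (i - m)))
        (at t within {0..})"
      unfolding v_def case_prod_beta by (intro DERIV_sum DERIV_mult K)
    also have "(\<Sum>(i, j)\<in>\<Lambda>.
        (heat_kernel (t / h\<^sup>2) (i - m + 1) + heat_kernel (t / h\<^sup>2) (i - m - 1) - 2 * heat_kernel (t / h\<^sup>2) (i - m)) * (1 / h\<^sup>2) * heat_kernel (t / h\<^sup>2) (j - n) +
        (heat_kernel (t / h\<^sup>2) (j - n + 1) + heat_kernel (t / h\<^sup>2) (j - n - 1) - 2 * heat_kernel (t / h\<^sup>2) (j - n)) * (1 / h\<^sup>2) * heat_kernel (t / h\<^sup>2) (i - m)) =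
        1 / h\<^sup>2 * (v (m + 1) n t + v (m - 1) n t + v m (n + 1) t + v m (n - 1) t - 4 * v m n t)"
      unfolding v_def sum_distrib_left sum.distrib[symmetric] sum_subtractf[symmetric]
      by (intro sum.cong refl) (auto simp: algebra_simps)
    finally have "(v m n has_real_derivative
        1 / h\<^sup>2 * (v (m + 1) n t + v (m - 1) n t + v m (n + 1) t + v m (n - 1) t - 4 * v m n t)) (at t within {0..})" .
    note v' = this
    have "(w m n has_real_derivative
        1 / h\<^sup>2 * (w (m + 1) n t + w (m - 1) n t + w m (n + 1) t + w m (n - 1) t - 4 * w m n t)) (at t within {0..})"
      using assms(1) t by (simp add: semidiscrete_heat_solution_def)
    then show "((\<lambda>t. w m n t - v m n t) has_real_derivative
        1 / h\<^sup>2 * ((w (m + 1) n t - v (m + 1) n t) + (w (m - 1) n t - v (m - 1) n t) +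
          (w m (n + 1) t - v m (n + 1) t) + (w m (n - 1) t - v m (n - 1) t) - 4 * (w m n t - v m n t))) (at t within {0..})"
      by (rule DERIV_cong[OF DERIV_diff[OF _ v']]) (simp add: algebra_simps)
  next
    fix m n :: int and t :: real assume t: "t \<ge> 0"
    have "\<bar>v m n t\<bar> \<le> (\<Sum>z\<in>\<Lambda>. 1)" for m n
      unfolding v_def using t
      by (intro sum_abs[THEN order.trans] sum_mono)
        (auto simp: abs_mult heat_kernel_bounds intro!: mult_le_one)
    then show "\<bar>w m n t - v m n t\<bar> \<le> B + real (card \<Lambda>)"
      using B[OF t, of m n] by (intro abs_triangle_ineq4[THEN order.trans] add_mono) auto
  next
    fix m n :: int
    have "v m n 0 = (\<Sum>z\<in>\<Lambda>. if z = (m, n) then 1 else 0)"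
      unfolding v_def by (intro sum.cong refl) (auto simp: heat_kernel_0 split: if_splits)
    then show "w m n 0 - v m n 0 = 0"
      using fin assms(1) by (simp add: semidiscrete_heat_solution_def \<Lambda>_def)
  qed (use assms in auto)
  then show ?thesis by (simp add: v_def \<Lambda>_def)
qed

section \<open>Central limit theorem for the walk\<close>

definition chi_square_cdf :: "real \<Rightarrow> real" where
  "chi_square_cdf c = measure std_normal_distribution {x. x\<^sup>2 \<le> c}"

text \<open>The exponent of the characteristic function of the walk divided by its standard
  deviation \<open>sqrt (2 * s)\<close>. The half-angle \<open>y\<close> satisfies
  \<open>t^2 = 8 * s * y^2\<close>, which turns the expression into \<open>(sin y / y)^2\<close>
  times the limit.\<close>

lemma cos_scaled_tendsto:
  "((\<lambda>s. 2 * s * (cos (t / sqrt (2 * s)) - 1)) \<longlongrightarrow> - t\<^sup>2 / 2) at_top"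
proof (cases "t = 0")
  case False
  let ?y = "\<lambda>s. t / (2 * sqrt (2 * s))"
  have "((\<lambda>y. sin y / y) \<longlongrightarrow> (1::real)) (at 0)"
    using DERIV_sin[of "0::real"] by (simp add: DERIV_def)
  moreover have "filterlim ?y (at 0) at_top"
    unfolding filterlim_at
  proof
    have "filterlim (\<lambda>s::real. 2 * sqrt (2 * s)) at_top at_top"
      by (intro filterlim_tendsto_pos_mult_at_top[OF tendsto_const] filterlim_compose[OF sqrt_at_top] filterlim_ident) auto
    then show "(?y \<longlongrightarrow> 0) at_top"
      by (rule tendsto_divide_0[OF tendsto_const filterlim_at_top_imp_at_infinity])
    show "\<forall>\<^sub>F s in at_top. ?y s \<in> UNIV \<and> ?y s \<noteq> 0"
      using eventually_gt_at_top[of 0] by eventually_elim (use False in simp)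
  qed
  ultimately have "((\<lambda>s. sin (?y s) / ?y s) \<longlongrightarrow> 1) at_top"
    by (rule filterlim_compose)
  then have "((\<lambda>s. - t\<^sup>2 / 2 * (sin (?y s) / ?y s)\<^sup>2) \<longlongrightarrow> - t\<^sup>2 / 2 * 1\<^sup>2) at_top"
    by (intro tendsto_intros)
  moreover have "\<forall>\<^sub>F s in at_top. - t\<^sup>2 / 2 * (sin (?y s) / ?y s)\<^sup>2 = 2 * s * (cos (t / sqrt (2 * s)) - 1)"
    using eventually_gt_at_top[of 0]
  proof eventually_elim
    case (elim s)
    define y where "y = ?y s"
    have cos: "cos (t / sqrt (2 * s)) - 1 = - (2 * (sin y)\<^sup>2)"
      using cos_double_sin[of y] by (simp add: y_def)
    have t: "t\<^sup>2 = 8 * s * y\<^sup>2" and "y \<noteq> 0"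
      using elim False by (simp_all add: y_def power_divide power_mult_distrib)
    then show ?case
      unfolding y_def[symmetric] cos t by (simp add: power_divide)
  qed
  ultimately show ?thesis by (simp add: tendsto_cong)
qed simp

lemma emeasure_std_normal_finite:
  assumes "finite A"
  shows "emeasure std_normal_distribution A = 0"
proof -
  have "A \<in> null_sets lborel" using assms by (simp add: null_setsI emeasure_lborel_countable countable_finite finite_imp_closed borel_closed)
  moreover have "absolutely_continuous lborel std_normal_distribution"
    by (rule absolutely_continuousI_density) simp
  ultimately show ?thesis by (auto simp: absolutely_continuous_def)
qed

lemma finite_square_eq: "finite {x::real. x\<^sup>2 = c}"
proof (rule finite_subset)
  show "{x. x\<^sup>2 = c} \<subseteq> {sqrt c, - sqrt c}"
    by (auto simp: abs_if)
qed auto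

text \<open>The square of a normal variable has no atoms. Continuity lets the perturbed curvatures
  in \<open>hit_tendsto\<close> return to \<open>\<kappa>\<close>.\<close>

lemma isCont_chi_square_cdf: "isCont chi_square_cdf c"
proof -
  interpret N: real_distribution std_normal_distribution by (rule real_dist_normal_dist)
  let ?D = "distr std_normal_distribution borel (\<lambda>x. x\<^sup>2)"
  interpret D: real_distribution ?D by (rule N.real_distribution_distr) simp
  have "chi_square_cdf = cdf ?D"
    by (rule ext) (simp add: chi_square_cdf_def cdf_def measure_distr vimage_def)
  moreover have "measure ?D {c} = 0"
    using emeasure_std_normal_finite[OF finite_square_eq[of c]]
    by (simp add: emeasure_distr vimage_def measure_def)
  ultimately show ?thesis using D.isCont_cdf[of c] by simp
qed

lemma walk_clt:
  "((\<lambda>s. measure (walk s) {j. (of_int j)\<^sup>2 \<le> c * (2 * s)}) \<longlongrightarrow> chi_square_cdf c) at_top"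
proof (rule tendsto_at_topI_sequentially)
  fix X :: "nat \<Rightarrow> real" assume X: "filterlim X at_top sequentially"
  \<comment> \<open>Levy's continuity theorem concerns sequences with every member a distribution.
    Replacing the finitely many nonpositive parameters by 1 makes the formula for the characteristic
    function valid for all \<open>n\<close>.\<close>
  define Y where "Y n = (if X n > 0 then X n else 1)" for n
  have ev: "\<forall>\<^sub>F n in sequentially. Y n = X n"
    using X[THEN filterlim_at_top_dense[THEN iffD1], rule_format, of 0]
    by eventually_elim (simp add: Y_def)
  have Y: "filterlim Y at_top sequentially"
    using X ev by (subst filterlim_cong[OF refl refl ev])
  have Y_pos: "Y n > 0" for n by (simp add: Y_def)
  define M where "M n = distr (measure_pmf (walk (Y n))) borel (\<lambda>j. of_int j / sqrt (2 * Y n))" for n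
  have M: "real_distribution (M n)" for n
    unfolding M_def by (rule prob_space.real_distribution_distr[OF measure_pmf.prob_space_axioms]) simp
  interpret N: real_distribution std_normal_distribution by (rule real_dist_normal_dist)
  have "char (M n) t = of_real (exp (2 * Y n * (cos (t / sqrt (2 * Y n)) - 1)))" for n t
    using expectation_walk_exp_i[OF Y_pos[of n], of "t / sqrt (2 * Y n)"]
    by (simp add: char_def M_def integral_distr)
  moreover have "(\<lambda>n. complex_of_real (exp (2 * Y n * (cos (t / sqrt (2 * Y n)) - 1)))) \<longlonglongrightarrow>
      of_real (exp (- t\<^sup>2 / 2))" for t
    by (intro tendsto_of_real tendsto_exp filterlim_compose[OF cos_scaled_tendsto Y])
  ultimately have "weak_conv_m M std_normal_distribution"
    by (intro levy_continuity M real_dist_normal_dist) (simp add: char_std_normal_distribution)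
  moreover have "emeasure std_normal_distribution (frontier {x. x\<^sup>2 \<le> c}) = 0"
  proof (rule emeasure_std_normal_finite, rule finite_subset[OF _ finite_square_eq[of c]])
    have "{x::real. x\<^sup>2 < c} \<subseteq> interior {x. x\<^sup>2 \<le> c}"
      by (intro interior_maximal open_Collect_less continuous_intros) auto
    moreover have "closed {x::real. x\<^sup>2 \<le> c}"
      by (intro closed_Collect_le continuous_intros)
    ultimately show "frontier {x. x\<^sup>2 \<le> c} \<subseteq> {x. x\<^sup>2 = c}"
      by (simp add: frontier_def subset_iff) (metis less_eq_real_def)
  qed
  ultimately have "(\<lambda>n. measure (M n) {x. x\<^sup>2 \<le> c}) \<longlonglongrightarrow> chi_square_cdf c"
    unfolding chi_square_cdf_def
    by (intro weak_conv_imp_continuity_set_conv M real_dist_normal_dist) auto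
  moreover have "measure (M n) {x. x\<^sup>2 \<le> c} = measure (walk (Y n)) {j. (of_int j)\<^sup>2 \<le> c * (2 * Y n)}" for n
    using Y_pos[of n] by (simp add: M_def measure_distr vimage_def power_divide pos_divide_le_eq)
  ultimately show "(\<lambda>n. measure (walk (X n)) {j. (of_int j)\<^sup>2 \<le> c * (2 * X n)}) \<longlonglongrightarrow> chi_square_cdf c"
    using ev by (elim Lim_transform_eventually) (auto elim!: eventually_mono)
qed

section \<open>Gaussian masses\<close>

text \<open>This handles the rows above the tip: in the limit they are never hit, which truncates
  the sum in \<open>lower_total\<close>.\<close>

lemma chi_square_cdf_nonpos: "c \<le> 0 \<Longrightarrow> chi_square_cdf c = 0"
proof -
  assume "c \<le> 0"
  then have "{x::real. x\<^sup>2 \<le> c} \<subseteq> {x. x\<^sup>2 \<le> 0}"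
    by (intro Collect_mono impI) (rule order.trans)
  then have "finite {x::real. x\<^sup>2 \<le> c}"
    by (rule finite_subset) simp
  then show ?thesis
    by (simp add: chi_square_cdf_def measure_def emeasure_std_normal_finite)
qed

lemma gauss_integrable: "(\<lambda>x::real. exp (- (x\<^sup>2 / 4))) integrable_on {a..b}"
  by (rule integrable_continuous_real) (auto intro!: continuous_intros)

text \<open>Rescaling by \<open>sqrt 2\<close> turns the normal density into the weight
  \<open>exp (- (x^2 / 4))\<close>, and evenness halves the interval. With
  \<open>c = k / (\<mu> * \<kappa>)\<close> the endpoint is exactly
  \<open>threshold \<mu> \<kappa> k\<close>.\<close>

lemma chi_square_cdf_eq_integral:
  assumes "c \<ge> 0"
  shows "sqrt pi * chi_square_cdf c = integral {0..sqrt (2 * c)} (\<lambda>x. exp (- (x\<^sup>2 / 4)))"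
proof -
  interpret N: real_distribution std_normal_distribution by (rule real_dist_normal_dist)
  define T where "T = sqrt (2 * c)"
  have T: "T \<ge> 0" "T\<^sup>2 = 2 * c" using assms by (auto simp: T_def)
  let ?g = "\<lambda>x::real. exp (- (x\<^sup>2 / 4))"
  let ?I = "indicator {x::real. x\<^sup>2 \<le> c} :: real \<Rightarrow> real"
  have "chi_square_cdf c = (\<integral>x. ?I x \<partial>std_normal_distribution)"
    unfolding chi_square_cdf_def by simp
  also have "\<dots> = (\<integral>x. std_normal_density x * ?I x \<partial>lborel)"
    by (subst integral_density) auto
  also have "\<dots> = \<bar>1 / sqrt 2\<bar> *\<^sub>R (\<integral>x. std_normal_density (0 + 1 / sqrt 2 * x) * ?I (0 + 1 / sqrt 2 * x) \<partial>lborel)"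
    by (intro lborel_integral_real_affine) auto
  also have "(\<lambda>x. std_normal_density (0 + 1 / sqrt 2 * x) * ?I (0 + 1 / sqrt 2 * x)) =
      (\<lambda>x. 1 / sqrt (2 * pi) * (indicator {-T..T} x *\<^sub>R ?g x))"
  proof (rule ext)
    fix x
    have "(1 / sqrt 2 * x)\<^sup>2 \<le> c \<longleftrightarrow> \<bar>x\<bar>\<^sup>2 \<le> \<bar>T\<bar>\<^sup>2"
      using T by (simp add: power_mult_distrib power_divide mult.commute)
    also have "\<dots> \<longleftrightarrow> x \<in> {-T..T}"
      using T by (subst power_mono_iff) auto
    finally show "std_normal_density (0 + 1 / sqrt 2 * x) * ?I (0 + 1 / sqrt 2 * x) =
      1 / sqrt (2 * pi) * (indicator {-T..T} x *\<^sub>R ?g x)"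
      by (simp add: normal_density_def indicator_def power_mult_distrib power_divide)
  qed
  also have "(\<integral>x. 1 / sqrt (2 * pi) * (indicator {-T..T} x *\<^sub>R ?g x) \<partial>lborel) =
      1 / sqrt (2 * pi) * integral {-T..T} ?g"
  proof -
    have "set_integrable lborel {-T..T} ?g"
      by (intro borel_integrable_compact[folded set_integrable_def] continuous_on_exp continuous_on_minus continuous_on_divide continuous_on_power continuous_on_id continuous_on_const) auto
    from set_borel_integral_eq_integral(2)[OF this] show ?thesis
      by (simp add: set_lebesgue_integral_def)
  qed
  also have "integral {-T..T} ?g = integral {-T..0} ?g + integral {0..T} ?g"
    using T by (intro Henstock_Kurzweil_Integration.integral_combine[symmetric] gauss_integrable) auto
  also have "integral {-T..0} ?g = integral {0..T} ?g"
    using Henstock_Kurzweil_Integration.integral_reflect_real[where a = 0 and b = T and f = ?g] by simp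
  finally have "chi_square_cdf c = 1 / ((sqrt 2 * sqrt 2) * sqrt pi) * (2 * integral {0..T} ?g)"
    by (simp add: real_sqrt_mult del: real_sqrt_mult_self)
  also have "\<dots> = integral {0..T} ?g / sqrt pi"
    by (simp del: real_sqrt_mult)
  finally show ?thesis
    unfolding T_def[symmetric] by simp
qed

lemma has_integral_gauss_half:
  "((\<lambda>x::real. exp (- (x\<^sup>2 / 4))) has_integral sqrt pi) {0..}"
proof -
  have "has_bochner_integral lborel (\<lambda>x::real. indicator {0..} (0 + 1/2 * x) *\<^sub>R exp (- (0 + 1/2 * x)\<^sup>2)) ((sqrt pi / 2) /\<^sub>R \<bar>1/2\<bar>)"
    by (intro lborel_has_bochner_integral_real_affine_iff[THEN iffD1] gaussian_moment_0) auto
  then have "has_bochner_integral lborel (\<lambda>x::real. indicator {0..} x *\<^sub>R exp (- (x\<^sup>2 / 4))) (sqrt pi)"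
    by (simp add: power_mult_distrib indicator_def zero_le_mult_iff power_divide)
  from has_integral_integral_lborel[of "\<lambda>x::real. indicator {0..} x *\<^sub>R exp (- (x\<^sup>2 / 4))"] this
  have "((\<lambda>x::real. indicator {0..} x *\<^sub>R exp (- (x\<^sup>2 / 4))) has_integral sqrt pi) UNIV"
    by (auto simp: has_bochner_integral_iff)
  then show ?thesis
    by (subst has_integral_restrict_UNIV[symmetric]) (simp add: indicator_def of_bool_def if_distrib[of "\<lambda>c. c * _"] cong: if_cong)
qed

lemma lower_mass_eq_chi_square_cdf:
  assumes "\<mu> > 0" "\<kappa> > 0"
  shows "lower_mass \<mu> \<kappa> k = sqrt pi * chi_square_cdf (k / (\<mu> * \<kappa>))"
proof -
  have "sqrt (2 * (real k / (\<mu> * \<kappa>))) = threshold \<mu> \<kappa> k" by (simp add: threshold_def)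
  then show ?thesis
    using chi_square_cdf_eq_integral[of "real k / (\<mu> * \<kappa>)"] assms
    unfolding lower_mass_def by simp
qed

lemma upper_mass_eq_chi_square_cdf:
  assumes "\<mu> > 0" "\<kappa> > 0"
  shows "upper_mass \<mu> \<kappa> k = sqrt pi * (1 - chi_square_cdf (k / (\<mu> * \<kappa>)))"
proof -
  let ?g = "\<lambda>x::real. exp (- (x\<^sup>2 / 4))"
  define T where "T = threshold \<mu> \<kappa> k"
  have T: "T \<ge> 0" using assms by (simp add: T_def threshold_def)
  have "((\<lambda>x. if x \<in> {0..} then ?g x else 0) has_integral sqrt pi) UNIV"
    using has_integral_gauss_half by (subst has_integral_restrict_UNIV)
  moreover have "((\<lambda>x. if x \<in> {0..T} then ?g x else 0) has_integral lower_mass \<mu> \<kappa> k) UNIV"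
    unfolding lower_mass_def T_def[symmetric]
    by (subst has_integral_restrict_UNIV) (intro integrable_integral gauss_integrable)
  ultimately have "((\<lambda>x. (if x \<in> {0..} then ?g x else 0) - (if x \<in> {0..T} then ?g x else 0)) has_integral
      sqrt pi - lower_mass \<mu> \<kappa> k) UNIV"
    by (rule has_integral_diff)
  \<comment> \<open>The integrands differ only at \<open>T\<close>, where the difference
    vanishes.\<close>
  then have "((\<lambda>x. if x \<in> {T..} then ?g x else 0) has_integral sqrt pi - lower_mass \<mu> \<kappa> k) UNIV"
    by (rule has_integral_spike_finite[of "{T}", rotated 2]) (use T in auto)
  then have "upper_mass \<mu> \<kappa> k = sqrt pi - lower_mass \<mu> \<kappa> k"
    unfolding upper_mass_def T_def[symmetric] by (subst (asm) has_integral_restrict_UNIV) (rule integral_unique)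
  then show ?thesis
    using lower_mass_eq_chi_square_cdf[OF assms] by (simp add: algebra_simps)
qed

text \<open>The bracket splits as \<open>?a k - ?b k\<close>: the finitely many nonzero
  \<open>?a k\<close> are the masses below row index \<open>n\<close>, the \<open>?b k\<close> are
  the upper masses from \<open>n + 1\<close> on. The two half-weighted masses at \<open>n\<close>
  combine to \<open>chi_square_cdf (n / (\<mu> * \<kappa>)) - 1 / 2\<close>.\<close>

lemma lower_total_minus_upper_total:
  assumes "\<mu> > 0" "\<kappa> > 0"
    and sum: "summable (\<lambda>k. chi_square_cdf ((real n - real (Suc k)) / (\<mu> * \<kappa>)) + chi_square_cdf ((real n + real (Suc k)) / (\<mu> * \<kappa>)) - 1)"
  shows "lower_total \<mu> \<kappa> n - upper_total \<mu> \<kappa> n = sqrt pi * (chi_square_cdf (real n / (\<mu> * \<kappa>)) - 1 / 2 +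
    (\<Sum>k. chi_square_cdf ((real n - real (Suc k)) / (\<mu> * \<kappa>)) + chi_square_cdf ((real n + real (Suc k)) / (\<mu> * \<kappa>)) - 1))"
proof -
  let ?\<Psi> = "\<lambda>x. chi_square_cdf (x / (\<mu> * \<kappa>))"
  let ?a = "\<lambda>k. ?\<Psi> (real n - real (Suc k))"
  let ?b = "\<lambda>k. 1 - ?\<Psi> (real n + real (Suc k))"
  have a0: "?a k = 0" if "k \<notin> {..<n}" for k
    using that assms by (intro chi_square_cdf_nonpos) (auto simp: divide_le_0_iff)
  have a: "?a sums (\<Sum>k<n. ?a k)"
    by (rule sums_finite) (use a0 in auto)
  have "(\<lambda>k. ?a k - (?a k - ?b k)) sums ((\<Sum>k<n. ?a k) - (\<Sum>k. ?a k - ?b k))"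
    using sum by (intro sums_diff a summable_sums) (simp add: algebra_simps)
  then have b: "?b sums ((\<Sum>k<n. ?a k) - (\<Sum>k. ?a k - ?b k))" by simp
  have "(\<Sum>k<n. ?a k) = (\<Sum>k=1..n - 1. ?\<Psi> (real k))"
  proof (cases n)
    case (Suc n')
    have "(\<Sum>k<n. ?a k) = (\<Sum>k<n. ?\<Psi> (real (n - Suc k)))"
      by (intro sum.cong refl) (auto simp: of_nat_diff)
    also have "\<dots> = (\<Sum>k<n. ?\<Psi> (real k))"
      by (rule sum.nat_diff_reindex)
    \<comment> \<open>The additional index 0 contributes
      \<open>chi_square_cdf 0 = 0\<close>.\<close>
    also have "\<dots> = (\<Sum>k=1..n - 1. ?\<Psi> (real k))"
      by (rule sum.mono_neutral_cong_right) (auto simp: Suc chi_square_cdf_nonpos not_le)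
    finally show ?thesis .
  qed simp
  moreover have "(\<Sum>\<^sub>\<infinity>k\<in>{n + 1..}. upper_mass \<mu> \<kappa> k) = sqrt pi * ((\<Sum>k<n. ?a k) - (\<Sum>k. ?a k - ?b k))"
  proof -
    \<comment> \<open>Nonnegativity turns the ordered series into the unordered sum of
      \<open>upper_total\<close>.\<close>
    have "?b k \<ge> 0" for k
      unfolding chi_square_cdf_def using prob_space.prob_le_1[OF real_distribution.axioms(1)[OF real_dist_normal_dist]] by simp
    then have "((\<lambda>k. sqrt pi * ?b k) has_sum (sqrt pi * ((\<Sum>k<n. ?a k) - (\<Sum>k. ?a k - ?b k)))) UNIV"
      using b by (intro has_sum_cmult_right) (simp add: sums_nonneg_imp_has_sum)
    then have "((\<lambda>k. upper_mass \<mu> \<kappa> (n + Suc k)) has_sum (sqrt pi * ((\<Sum>k<n. ?a k) - (\<Sum>k. ?a k - ?b k)))) UNIV"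
      by (simp only: upper_mass_eq_chi_square_cdf[OF assms(1,2)] of_nat_add)
    then have "(upper_mass \<mu> \<kappa> has_sum (sqrt pi * ((\<Sum>k<n. ?a k) - (\<Sum>k. ?a k - ?b k)))) (range (\<lambda>k. n + Suc k))"
      by (subst has_sum_reindex) (auto simp only: o_def inj_on_def)
    moreover have "range (\<lambda>k. n + Suc k) = {n + 1..}"
      by (auto simp: image_iff le_iff_add intro: exI[of _ "_ - n - 1"])
    ultimately show ?thesis
      by (simp only: infsumI)
  qed
  ultimately show ?thesis
    unfolding lower_total_def upper_total_def
    using lower_mass_eq_chi_square_cdf[OF assms(1,2)] upper_mass_eq_chi_square_cdf[OF assms(1,2), of n]
    by (simp add: sum_distrib_left[symmetric] algebra_simps)
qed

section \<open>The walk near a parabolic tip\<close>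

text \<open>Diffusive time is \<open>s = \<tau> / h\<^sup>2 = \<mu> / h\<close>, so that the mesh size is \<open>\<mu> / s\<close>.\<close>
locale parabolic_tip =
  fixes \<Omega> :: "(real \<times> real) set" and f :: "real \<Rightarrow> real" and c\<^sub>0 \<kappa> \<mu> :: real
  assumes mu: "\<mu> > 0" and kappa: "\<kappa> > 0" and c0: "c\<^sub>0 > 0"
    and bounded: "bounded \<Omega>"
    and local_graph: "\<And>\<epsilon>. \<epsilon> > 0 \<Longrightarrow> \<exists>\<delta>>0. \<forall>x y. \<bar>x\<bar> < \<delta> \<longrightarrow> \<bar>y\<bar> < c\<^sub>0 \<longrightarrow>
      ((x, y) \<in> \<Omega> \<longleftrightarrow> y \<le> f x) \<and> \<bar>f x + \<kappa> * x\<^sup>2 / 2\<bar> \<le> \<epsilon> * x\<^sup>2"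
begin

definition hit :: "real \<Rightarrow> real \<Rightarrow> int set" where
  "hit s y = {i. (of_int i * (\<mu> / s), y * (\<mu> / s)) \<in> \<Omega>}"

text \<open>Columns outside the window of the graph description. Membership in the region is unknown
  there, so their probability enters every estimate as an error.\<close>

definition far :: "real \<Rightarrow> real \<Rightarrow> int set" where
  "far \<delta> s = {i. \<delta> \<le> \<bar>of_int i * (\<mu> / s)\<bar>}"

lemma prob_far_le:
  assumes "s \<ge> 1" "\<delta> > 0"
  shows "measure (walk s) (far \<delta> s) \<le> 1440 * exp 2 * (\<mu> / \<delta>) ^ 6 / s ^ 3"
proof -
  have "far \<delta> s = {i. \<delta> * s / \<mu> \<le> \<bar>of_int i\<bar>}"
    using assms mu by (auto simp: far_def abs_mult field_simps)
  then have "measure (walk s) (far \<delta> s) \<le> 1440 * exp 2 * (s / (\<delta> * s / \<mu>)\<^sup>2) ^ 3"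
    using walk_tail[of s "\<delta> * s / \<mu>"] assms mu by simp
  also have "s / (\<delta> * s / \<mu>)\<^sup>2 = (\<mu> / \<delta>)\<^sup>2 / s"
    using assms mu by (simp add: field_simps power2_eq_square)
  finally show ?thesis by (simp add: power_divide power_mult_distrib flip: power_mult)
qed

lemma prob_far_tendsto: "\<delta> > 0 \<Longrightarrow> ((\<lambda>s. measure (walk s) (far \<delta> s)) \<longlongrightarrow> 0) at_top"
proof (rule tendsto_sandwich[OF _ _ tendsto_const])
  assume d: "\<delta> > 0"
  show "\<forall>\<^sub>F s in at_top. measure (walk s) (far \<delta> s) \<le> 1440 * exp 2 * (\<mu> / \<delta>) ^ 6 / s ^ 3"
    using eventually_ge_at_top[of 1] by eventually_elim (rule prob_far_le[OF _ d])
  show "((\<lambda>s. 1440 * exp 2 * (\<mu> / \<delta>) ^ 6 / s ^ 3) \<longlongrightarrow> 0) at_top"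
    by (intro tendsto_divide_0[OF tendsto_const] filterlim_at_top_imp_at_infinity
        filterlim_pow_at_top filterlim_ident) auto
qed simp

text \<open>Inside the window the boundary lies between the parabolas of curvature
  \<open>\<kappa> + \<eta>\<close> and \<open>\<kappa> - \<eta>\<close>, so the row is squeezed
  between two events of the form required by \<open>walk_clt\<close>, up to far columns. The real
  number \<open>k\<close> may have either sign.\<close>

lemma hit_tendsto:
  "((\<lambda>s. measure (walk s) (hit s (- k))) \<longlongrightarrow> chi_square_cdf (k / (\<mu> * \<kappa>))) at_top"
proof -
  let ?\<Psi> = "\<lambda>\<eta>. chi_square_cdf (k / (\<mu> * (\<kappa> + \<eta>)))"
  let ?P = "\<lambda>\<eta> s. measure (walk s) {i. (of_int i)\<^sup>2 \<le> k / (\<mu> * (\<kappa> + \<eta>)) * (2 * s)}"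
  have cont: "(?\<Psi> \<longlongrightarrow> chi_square_cdf (k / (\<mu> * \<kappa>))) (at_right 0)" "((\<lambda>\<eta>. ?\<Psi> (- \<eta>)) \<longlongrightarrow> chi_square_cdf (k / (\<mu> * \<kappa>))) (at_right 0)"
    using mu kappa by (auto intro!: isCont_tendsto_compose[OF isCont_chi_square_cdf] tendsto_eq_intros)
  have hit_iff: "\<exists>\<delta>>0. \<forall>\<^sub>F s in at_top. \<forall>i. i \<notin> far \<delta> s \<longrightarrow>
      ((of_int i)\<^sup>2 \<le> k / (\<mu> * (\<kappa> + \<eta>)) * (2 * s) \<longrightarrow> i \<in> hit s (- k)) \<and>
      (i \<in> hit s (- k) \<longrightarrow> (of_int i)\<^sup>2 \<le> k / (\<mu> * (\<kappa> + - \<eta>)) * (2 * s))"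
    if \<eta>: "0 < \<eta>" "\<eta> < \<kappa>" for \<eta>
  proof -
    obtain \<delta> where \<delta>: "\<delta> > 0" "\<And>x y. \<bar>x\<bar> < \<delta> \<Longrightarrow> \<bar>y\<bar> < c\<^sub>0 \<Longrightarrow>
      ((x, y) \<in> \<Omega> \<longleftrightarrow> y \<le> f x) \<and> \<bar>f x + \<kappa> * x\<^sup>2 / 2\<bar> \<le> \<eta> / 2 * x\<^sup>2"
      using local_graph[of "\<eta> / 2"] \<eta> by auto
    have "((\<lambda>s. \<bar>- k * (\<mu> / s)\<bar>) \<longlongrightarrow> \<bar>- k * 0\<bar>) at_top"
      by (intro tendsto_intros tendsto_divide_0[OF tendsto_const] filterlim_at_top_imp_at_infinity filterlim_ident)
    then have "\<forall>\<^sub>F s in at_top. \<bar>- k * (\<mu> / s)\<bar> < c\<^sub>0"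
      using c0 by (intro order_tendstoD(2)) auto
    then have "\<forall>\<^sub>F s in at_top. \<forall>i. i \<notin> far \<delta> s \<longrightarrow>
      ((of_int i)\<^sup>2 \<le> k / (\<mu> * (\<kappa> + \<eta>)) * (2 * s) \<longrightarrow> i \<in> hit s (- k)) \<and>
      (i \<in> hit s (- k) \<longrightarrow> (of_int i)\<^sup>2 \<le> k / (\<mu> * (\<kappa> + - \<eta>)) * (2 * s))"
      using eventually_gt_at_top[of 0]
    proof (eventually_elim, intro allI impI)
      fix s :: real and i :: int
      assume s: "\<bar>- k * (\<mu> / s)\<bar> < c\<^sub>0" "0 < s" and "i \<notin> far \<delta> s"
      define x where "x = of_int i * (\<mu> / s)"
      have "\<bar>x\<bar> < \<delta>" using \<open>i \<notin> far \<delta> s\<close> by (simp add: far_def x_def)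
      with \<delta>(2)[OF this s(1)] have f: "i \<in> hit s (- k) \<longleftrightarrow> - k * (\<mu> / s) \<le> f x" "\<bar>f x + \<kappa> * x\<^sup>2 / 2\<bar> \<le> \<eta> / 2 * x\<^sup>2"
        by (auto simp: hit_def x_def)
      have iff: "(of_int i)\<^sup>2 \<le> k / (\<mu> * (\<kappa> + e)) * (2 * s) \<longleftrightarrow> - k * (\<mu> / s) \<le> - ((\<kappa> + e) * x\<^sup>2 / 2)"
        if "\<kappa> + e > 0" for e
      proof -
        have "(of_int i)\<^sup>2 \<le> k / (\<mu> * (\<kappa> + e)) * (2 * s) \<longleftrightarrow> 0 \<le> 2 * k * s - (of_int i)\<^sup>2 * (\<mu> * (\<kappa> + e))"
          using that mu by (simp add: pos_le_divide_eq mult_ac)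
        also have "\<dots> \<longleftrightarrow> 0 \<le> (2 * k * s - (of_int i)\<^sup>2 * (\<mu> * (\<kappa> + e))) * (\<mu> / (2 * s\<^sup>2))"
          using s(2) mu by (simp add: zero_le_mult_iff zero_le_divide_iff)
        also have "(2 * k * s - (of_int i)\<^sup>2 * (\<mu> * (\<kappa> + e))) * (\<mu> / (2 * s\<^sup>2)) =
            - ((\<kappa> + e) * x\<^sup>2 / 2) - - k * (\<mu> / s)"
          using s(2) by (simp add: x_def field_simps power2_eq_square)
        finally show ?thesis by simp
      qed
      show "((of_int i)\<^sup>2 \<le> k / (\<mu> * (\<kappa> + \<eta>)) * (2 * s) \<longrightarrow> i \<in> hit s (- k)) \<and>
          (i \<in> hit s (- k) \<longrightarrow> (of_int i)\<^sup>2 \<le> k / (\<mu> * (\<kappa> + - \<eta>)) * (2 * s))"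
      proof -
        have "- ((\<kappa> + \<eta>) * x\<^sup>2 / 2) \<le> f x" "f x \<le> - ((\<kappa> + - \<eta>) * x\<^sup>2 / 2)"
          using abs_le_D1[OF f(2)] abs_le_D2[OF f(2)]
          by (simp_all only: distrib_right mult_minus_left add_divide_distrib)
        moreover have "0 < \<kappa> + \<eta>" "0 < \<kappa> + - \<eta>" using \<eta> by auto
        ultimately show ?thesis
          unfolding f(1) using iff by (meson order.trans)
      qed
    qed
    with \<delta>(1) show ?thesis by blast
  qed
  have ev_kappa: "\<forall>\<^sub>F \<eta> in at_right 0. 0 < \<eta> \<and> \<eta> < \<kappa>"
    using kappa eventually_at_right_less[of 0] eventually_at_right_real[of 0 \<kappa>] by (auto elim: eventually_mono)
  show ?thesis
  proof (rule order_tendstoI)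
    fix a assume "chi_square_cdf (k / (\<mu> * \<kappa>)) < a"
    \<comment> \<open>One \<open>\<eta>\<close> is fixed with room to spare below \<open>a\<close>
      before \<open>s\<close> tends to infinity.\<close>
    from eventually_happens[OF eventually_conj[OF order_tendstoD(2)[OF cont(2) this] ev_kappa]]
    obtain \<eta> where \<eta>: "?\<Psi> (- \<eta>) < a" "0 < \<eta>" "\<eta> < \<kappa>" by auto
    from hit_iff[OF \<eta>(2,3)] obtain \<delta> where \<delta>: "\<delta> > 0" and ev: "\<forall>\<^sub>F s in at_top. \<forall>i. i \<notin> far \<delta> s \<longrightarrow>
      ((of_int i)\<^sup>2 \<le> k / (\<mu> * (\<kappa> + \<eta>)) * (2 * s) \<longrightarrow> i \<in> hit s (- k)) \<and>
      (i \<in> hit s (- k) \<longrightarrow> (of_int i)\<^sup>2 \<le> k / (\<mu> * (\<kappa> + - \<eta>)) * (2 * s))" by auto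
    have "((\<lambda>s. ?P (- \<eta>) s + measure (walk s) (far \<delta> s)) \<longlongrightarrow> ?\<Psi> (- \<eta>) + 0) at_top"
      by (intro tendsto_add walk_clt prob_far_tendsto \<delta>)
    then have "\<forall>\<^sub>F s in at_top. ?P (- \<eta>) s + measure (walk s) (far \<delta> s) < a"
      using \<eta> by (intro order_tendstoD(2)) auto
    with ev show "\<forall>\<^sub>F s in at_top. measure (walk s) (hit s (- k)) < a"
    proof eventually_elim
      case (elim s)
      then have "measure (walk s) (hit s (- k)) \<le>
          measure (walk s) ({i. (of_int i)\<^sup>2 \<le> k / (\<mu> * (\<kappa> + - \<eta>)) * (2 * s)} \<union> far \<delta> s)"
        by (intro measure_pmf.finite_measure_mono) auto
      also have "\<dots> \<le> ?P (- \<eta>) s + measure (walk s) (far \<delta> s)"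
        by (rule measure_Un_le) auto
      finally show ?case using elim by simp
    qed
  next
    fix a assume "a < chi_square_cdf (k / (\<mu> * \<kappa>))"
    from eventually_happens[OF eventually_conj[OF order_tendstoD(1)[OF cont(1) this] ev_kappa]]
    obtain \<eta> where \<eta>: "a < ?\<Psi> \<eta>" "0 < \<eta>" "\<eta> < \<kappa>" by auto
    from hit_iff[OF \<eta>(2,3)] obtain \<delta> where \<delta>: "\<delta> > 0" and ev: "\<forall>\<^sub>F s in at_top. \<forall>i. i \<notin> far \<delta> s \<longrightarrow>
      ((of_int i)\<^sup>2 \<le> k / (\<mu> * (\<kappa> + \<eta>)) * (2 * s) \<longrightarrow> i \<in> hit s (- k)) \<and>
      (i \<in> hit s (- k) \<longrightarrow> (of_int i)\<^sup>2 \<le> k / (\<mu> * (\<kappa> + - \<eta>)) * (2 * s))" by auto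
    have "((\<lambda>s. ?P \<eta> s - measure (walk s) (far \<delta> s)) \<longlongrightarrow> ?\<Psi> \<eta> - 0) at_top"
      by (intro tendsto_diff walk_clt prob_far_tendsto \<delta>)
    then have "\<forall>\<^sub>F s in at_top. a < ?P \<eta> s - measure (walk s) (far \<delta> s)"
      using \<eta> by (intro order_tendstoD(1)) auto
    with ev show "\<forall>\<^sub>F s in at_top. a < measure (walk s) (hit s (- k))"
    proof eventually_elim
      case (elim s)
      then have "?P \<eta> s \<le> measure (walk s) (hit s (- k) \<union> far \<delta> s)"
        by (intro measure_pmf.finite_measure_mono) auto
      also have "\<dots> \<le> measure (walk s) (hit s (- k)) + measure (walk s) (far \<delta> s)"
        by (rule measure_Un_le) auto
      finally show ?case using elim by simp
    qed
  qed
qed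

end

section \<open>Uniform domination of the paired terms, and the series for the solution\<close>

lemma has_sum_pmf: "(pmf p has_sum 1) UNIV"
proof -
  have abs: "Infinite_Set_Sum.abs_summable_on (pmf p) UNIV"
    by (rule pmf_abs_summable)
  have "infsum (pmf p) UNIV = 1"
    using infsetsum_infsum[OF abs] infsetsum_pmf_eq_1[of p UNIV] by simp
  moreover have "pmf p summable_on UNIV"
    using abs unfolding abs_summable_equivalent[symmetric] by (rule abs_summable_summable)
  ultimately show ?thesis by (metis has_sum_infsum)
qed

lemma heat_kernel_0_pos:
  assumes "s \<ge> 1"
  shows "heat_kernel s 0 > 0"
proof -
  have "0 < exp (- 1) / (pi * sqrt s)" using assms by simp
  then show ?thesis using heat_kernel_0_ge[OF assms] by linarith
qed

lemma heat_kernel_ratio_bounds: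
  assumes "s \<ge> 1"
  shows "0 \<le> heat_kernel s j / heat_kernel s 0" "heat_kernel s j / heat_kernel s 0 \<le> 1"
  using heat_kernel_0_pos[OF assms] heat_kernel_le_0[of s j] heat_kernel_bounds[of s j] assms by auto

text \<open>For rows so remote that the graph description fails, this decay is the only information.
  Weakening \<open>sqrt s\<close> to \<open>s\<close> keeps the powers integral.\<close>

lemma heat_kernel_ratio_le:
  assumes "s \<ge> 1" "j > 0"
  shows "heat_kernel s (int j) / heat_kernel s 0 \<le> 1440 * exp 3 * pi * s ^ 4 / real j ^ 6"
proof -
  have "heat_kernel s (int j) = measure (walk s) {int j}"
    using assms by (simp add: heat_kernel_eq_pmf measure_pmf_single)
  also have "\<dots> \<le> measure (walk s) {i. real j \<le> \<bar>of_int i\<bar>}"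
    by (intro measure_pmf.finite_measure_mono) auto
  also have "\<dots> \<le> 1440 * exp 2 * (s / (real j)\<^sup>2) ^ 3"
    using assms by (intro walk_tail) auto
  finally have K: "heat_kernel s (int j) \<le> 1440 * exp 2 * s ^ 3 / real j ^ 6"
    by (simp add: power_divide flip: power_mult)
  have "sqrt s \<le> s" using assms by (simp add: real_le_lsqrt power2_eq_square)
  then have "exp (- 1) / (pi * s) \<le> exp (- 1) / (pi * sqrt s)"
    using assms by (intro divide_left_mono) auto
  then have K0: "exp (- 1) / (pi * s) \<le> heat_kernel s 0"
    using heat_kernel_0_ge[OF assms(1)] by linarith
  have "heat_kernel s (int j) / heat_kernel s 0 \<le>
      (1440 * exp 2 * s ^ 3 / real j ^ 6) / (exp (- 1) / (pi * s))"
    using assms K K0 by (intro frac_le) auto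
  also have "\<dots> = 1440 * (exp 2 / exp (- 1)) * pi * s ^ 4 / real j ^ 6"
    using assms by (simp add: field_simps eval_nat_numeral)
  also have "exp 2 / exp (- 1) = exp (3::real)"
    by (simp flip: exp_diff)
  finally show ?thesis .
qed

context parabolic_tip
begin

text \<open>The rows \<open>- (n - j)\<close> and \<open>- (n + j)\<close> are the two at distance
  \<open>j\<close> from the starting row \<open>- n\<close>.\<close>

definition tip_term :: "nat \<Rightarrow> real \<Rightarrow> nat \<Rightarrow> real" where
  "tip_term n s j = heat_kernel s (int j) / heat_kernel s 0 *
    (measure (walk s) (hit s (- (real n - real j))) + measure (walk s) (hit s (- (real n + real j))) - 1)"

lemma tip_term_tendsto:
  "((\<lambda>s. tip_term n s j) \<longlongrightarrow>
    chi_square_cdf ((real n - real j) / (\<mu> * \<kappa>)) + chi_square_cdf ((real n + real j) / (\<mu> * \<kappa>)) - 1) at_top"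
proof -
  have "((\<lambda>s. tip_term n s j) \<longlongrightarrow>
    1 * (chi_square_cdf ((real n - real j) / (\<mu> * \<kappa>)) + chi_square_cdf ((real n + real j) / (\<mu> * \<kappa>)) - 1)) at_top"
    unfolding tip_term_def by (intro tendsto_intros heat_kernel_ratio_tendsto hit_tendsto)
  then show ?thesis by simp
qed

text \<open>For \<open>j > n\<close> one row of the pair is strictly above the tip and is hit only
  from far columns, while the other is missed only from far columns or columns beyond the parabola.
  Hence the bracket is a difference of two small probabilities, unless a row may leave the window,
  in which case the kernel ratio is small.\<close>

lemma tip_term_bound:
  obtains C where "\<And>s j. s \<ge> 1 \<Longrightarrow> j > n \<Longrightarrow> \<bar>tip_term n s j\<bar> \<le> C / (real j)\<^sup>2"
proof -
  \<comment> \<open>Tolerance \<open>\<kappa> / 4\<close> keeps \<open>f x\<close> between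
    \<open>- 3/4 * \<kappa> * x^2\<close> and \<open>- 1/4 * \<kappa> * x^2\<close>: nonpositive,
    yet not too low.\<close>
  obtain \<delta> where \<delta>: "\<delta> > 0" "\<And>x y. \<bar>x\<bar> < \<delta> \<Longrightarrow> \<bar>y\<bar> < c\<^sub>0 \<Longrightarrow>
      ((x, y) \<in> \<Omega> \<longleftrightarrow> y \<le> f x) \<and> \<bar>f x + \<kappa> * x\<^sup>2 / 2\<bar> \<le> \<kappa> / 4 * x\<^sup>2"
    using local_graph[of "\<kappa> / 4"] kappa by auto
  \<comment> \<open>\<open>C1\<close> serves the rows outside the window, where
    \<open>s \<le> 2 * \<mu> / c\<^sub>0 * j\<close>. \<open>C2\<close> collects two far-column
    errors and the tail beyond the parabola.\<close>
  define C1 where "C1 = 1440 * exp 3 * pi * (2 * \<mu> / c\<^sub>0) ^ 4"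
  define C2 where "C2 = 2 * (1440 * exp 2 * (\<mu> / \<delta>) ^ 6 * (c\<^sub>0 / \<mu>)\<^sup>2) + 1440 * exp 2 * (\<mu> * \<kappa>) ^ 3"
  have pos: "0 \<le> C1" "0 \<le> C2" using mu kappa c0 \<delta> by (auto simp: C1_def C2_def)
  have "\<bar>tip_term n s j\<bar> \<le> (C1 + C2) / (real j)\<^sup>2" if s: "s \<ge> 1" and j: "j > n" for s j
  proof (cases "c\<^sub>0 \<le> (real n + real j) * (\<mu> / s)")
    case True
    let ?p = "measure (walk s) (hit s (- (real n - real j)))" and ?q = "measure (walk s) (hit s (- (real n + real j)))"
    have "?p \<le> 1" "?q \<le> 1" by (rule measure_pmf.prob_le_1)+
    moreover have "0 \<le> ?p" "0 \<le> ?q" by (rule measure_nonneg)+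
    ultimately have "\<bar>?p + ?q - 1\<bar> \<le> 1" by linarith
    then have "\<bar>tip_term n s j\<bar> \<le> heat_kernel s (int j) / heat_kernel s 0 * 1"
      using heat_kernel_ratio_bounds[OF s, of "int j"] unfolding tip_term_def abs_mult
      by (intro mult_mono) auto
    also have "\<dots> \<le> 1440 * exp 3 * pi * s ^ 4 / real j ^ 6"
      using heat_kernel_ratio_le[OF s, of j] j by simp
    also have "\<dots> \<le> 1440 * exp 3 * pi * (2 * \<mu> / c\<^sub>0 * real j) ^ 4 / real j ^ 6"
    proof -
      have "c\<^sub>0 * s \<le> (real n + real j) * \<mu>" using True s by (simp add: field_simps)
      also have "\<dots> \<le> (2 * real j) * \<mu>" using j mu by (intro mult_right_mono) auto
      finally have "s \<le> 2 * \<mu> / c\<^sub>0 * real j" using c0 by (simp add: field_simps)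
      then show ?thesis using s by (intro divide_right_mono mult_left_mono power_mono) auto
    qed
    also have "\<dots> = C1 / (real j)\<^sup>2"
      using j by (simp add: C1_def power_mult_distrib field_simps eval_nat_numeral)
    also have "\<dots> \<le> (C1 + C2) / (real j)\<^sup>2" using pos by (intro divide_right_mono) auto
    finally show ?thesis .
  next
    case False
    have jpos: "real j > 0" and spos: "s > 0" using j s by auto
    let ?p = "measure (walk s) (hit s (- (real n - real j)))" and ?q = "measure (walk s) (- hit s (- (real n + real j)))"
    have inside: "\<bar>- (real n + e * real j) * (\<mu> / s)\<bar> < c\<^sub>0" if "\<bar>e\<bar> \<le> 1" for e
    proof -
      have "\<bar>- (real n + e * real j)\<bar> \<le> real n + real j"
        using that abs_triangle_ineq[of "real n" "e * real j"] mult_right_mono[of "\<bar>e\<bar>" 1 "real j"]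
        by (simp add: abs_mult)
      then have "\<bar>- (real n + e * real j)\<bar> * (\<mu> / s) \<le> (real n + real j) * (\<mu> / s)"
        using mu spos by (intro mult_right_mono) auto
      then show ?thesis using False mu spos by (simp add: abs_mult)
    qed
    have "hit s (- (real n - real j)) \<subseteq> far \<delta> s"
    proof
      fix i assume i: "i \<in> hit s (- (real n - real j))"
      show "i \<in> far \<delta> s"
      proof (rule ccontr)
        assume "i \<notin> far \<delta> s"
        define x where "x = of_int i * (\<mu> / s)"
        have "\<bar>x\<bar> < \<delta>" using \<open>i \<notin> far \<delta> s\<close> by (simp add: far_def x_def)
        moreover have "\<bar>- (real n - real j) * (\<mu> / s)\<bar> < c\<^sub>0" using inside[of "- 1"] by simp
        ultimately have local: "((x, - (real n - real j) * (\<mu> / s)) \<in> \<Omega> \<longleftrightarrow> - (real n - real j) * (\<mu> / s) \<le> f x) \<and>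
            \<bar>f x + \<kappa> * x\<^sup>2 / 2\<bar> \<le> \<kappa> / 4 * x\<^sup>2"
          by (rule \<delta>(2))
        have "- (real n - real j) * (\<mu> / s) \<le> f x"
          using i local unfolding hit_def x_def mem_Collect_eq by blast
        moreover have "f x + \<kappa> * x\<^sup>2 / 2 \<le> \<kappa> / 4 * x\<^sup>2"
          using local by (blast intro: abs_le_D1)
        moreover have "0 \<le> \<kappa> * x\<^sup>2" using kappa by simp
        moreover have "0 < - (real n - real j) * (\<mu> / s)" using j mu spos by (intro mult_pos_pos) auto
        ultimately show False by linarith
      qed
    qed
    then have p: "?p \<le> measure (walk s) (far \<delta> s)"
      by (intro measure_pmf.finite_measure_mono) auto
    \<comment> \<open>Columns with \<open>\<bar>i\<bar> \<le> a\<close> satisfy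
      \<open>\<kappa> * x^2 \<le> j * (\<mu> / s)\<close>, so the boundary drops there by at most
      \<open>3/4 * j\<close> rows and the row \<open>- (n + j)\<close> is still hit.\<close>
    define a where "a = sqrt (real j * s / (\<mu> * \<kappa>))"
    have a: "a > 0" "a\<^sup>2 = real j * s / (\<mu> * \<kappa>)" using jpos spos mu kappa by (auto simp: a_def)
    have "- hit s (- (real n + real j)) \<subseteq> far \<delta> s \<union> {i. a \<le> \<bar>of_int i\<bar>}"
    proof (safe, rule ccontr)
      fix i assume i: "i \<notin> hit s (- (real n + real j))" "i \<notin> far \<delta> s" "\<not> a \<le> \<bar>of_int i\<bar>"
      define x where "x = of_int i * (\<mu> / s)"
      have "\<bar>x\<bar> < \<delta>" using i(2) by (simp add: far_def x_def)
      moreover have "\<bar>- (real n + real j) * (\<mu> / s)\<bar> < c\<^sub>0" using inside[of 1] by simp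
      ultimately have local: "((x, - (real n + real j) * (\<mu> / s)) \<in> \<Omega> \<longleftrightarrow> - (real n + real j) * (\<mu> / s) \<le> f x) \<and>
          \<bar>f x + \<kappa> * x\<^sup>2 / 2\<bar> \<le> \<kappa> / 4 * x\<^sup>2"
        by (rule \<delta>(2))
      have f: "f x < - (real n + real j) * (\<mu> / s)"
        using local i(1) unfolding hit_def x_def mem_Collect_eq not_le[symmetric] by blast
      have f': "- (f x + \<kappa> * x\<^sup>2 / 2) \<le> \<kappa> / 4 * x\<^sup>2"
        using local by (blast intro: abs_le_D2)
      have "(of_int i)\<^sup>2 \<le> a\<^sup>2" using i(3) a(1) by (intro abs_le_square_iff[THEN iffD1]) auto
      then have "(of_int i)\<^sup>2 * (\<mu>\<^sup>2 * \<kappa> / s\<^sup>2) \<le> a\<^sup>2 * (\<mu>\<^sup>2 * \<kappa> / s\<^sup>2)"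
        using kappa by (intro mult_right_mono) auto
      then have "\<kappa> * x\<^sup>2 \<le> real j * (\<mu> / s)"
        unfolding a(2) using spos mu kappa by (simp add: x_def field_simps power2_eq_square)
      moreover have "0 \<le> \<kappa> * x\<^sup>2" "0 \<le> real n * (\<mu> / s)" using kappa mu spos by auto
      ultimately show False using f f' by (simp add: algebra_simps)
    qed
    then have "?q \<le> measure (walk s) (far \<delta> s \<union> {i. a \<le> \<bar>of_int i\<bar>})"
      by (intro measure_pmf.finite_measure_mono) auto
    also have "\<dots> \<le> measure (walk s) (far \<delta> s) + measure (walk s) {i. a \<le> \<bar>of_int i\<bar>}"
      by (rule measure_Un_le) auto
    finally have q: "?q \<le> measure (walk s) (far \<delta> s) + measure (walk s) {i. a \<le> \<bar>of_int i\<bar>}" .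
    have "measure (walk s) {i. a \<le> \<bar>of_int i\<bar>} \<le> 1440 * exp 2 * (s / a\<^sup>2) ^ 3"
      by (rule walk_tail[OF s a(1)])
    also have "s / a\<^sup>2 = \<mu> * \<kappa> / real j" unfolding a(2) using spos jpos mu kappa by simp
    also have "(\<mu> * \<kappa> / real j) ^ 3 \<le> (\<mu> * \<kappa>) ^ 3 / (real j)\<^sup>2"
      unfolding power_divide using j mu kappa by (intro divide_left_mono power_increasing) auto
    finally have q': "measure (walk s) {i. a \<le> \<bar>of_int i\<bar>} \<le> 1440 * exp 2 * (\<mu> * \<kappa>) ^ 3 / (real j)\<^sup>2"
      by simp
    have "measure (walk s) (far \<delta> s) \<le> 1440 * exp 2 * (\<mu> / \<delta>) ^ 6 / s ^ 3"
      by (rule prob_far_le[OF s \<delta>(1)])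
    also have "\<dots> \<le> 1440 * exp 2 * (\<mu> / \<delta>) ^ 6 / s\<^sup>2"
      using s mu \<delta> by (intro divide_left_mono power_increasing) auto
    also have "\<dots> \<le> 1440 * exp 2 * (\<mu> / \<delta>) ^ 6 / (real j * (\<mu> / c\<^sub>0))\<^sup>2"
    proof -
      have "real j * \<mu> \<le> (real n + real j) * \<mu>" using mu by (intro mult_right_mono) auto
      also have "\<dots> \<le> c\<^sub>0 * s" using False spos by (simp add: field_simps)
      finally have "real j * (\<mu> / c\<^sub>0) \<le> s" using c0 by (simp add: field_simps)
      then show ?thesis
        using s mu \<delta> c0 jpos by (intro divide_left_mono power_mono) auto
    qed
    also have "\<dots> = 1440 * exp 2 * (\<mu> / \<delta>) ^ 6 * (c\<^sub>0 / \<mu>)\<^sup>2 / (real j)\<^sup>2"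
      using mu c0 jpos by (simp add: power_mult_distrib power_divide field_simps)
    finally have far: "measure (walk s) (far \<delta> s) \<le> 1440 * exp 2 * (\<mu> / \<delta>) ^ 6 * (c\<^sub>0 / \<mu>)\<^sup>2 / (real j)\<^sup>2" .
    have "measure (walk s) (hit s (- (real n + real j))) = 1 - ?q"
      using measure_pmf.prob_compl[of "hit s (- (real n + real j))" "walk s"] by (simp add: Compl_eq_Diff_UNIV)
    then have "tip_term n s j = heat_kernel s (int j) / heat_kernel s 0 * (?p - ?q)"
      unfolding tip_term_def by (simp only:) simp
    then have "\<bar>tip_term n s j\<bar> = heat_kernel s (int j) / heat_kernel s 0 * \<bar>?p - ?q\<bar>"
      using heat_kernel_ratio_bounds(1)[OF s, of "int j"] by (simp only: abs_mult abs_of_nonneg)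
    also have "\<dots> \<le> 1 * \<bar>?p - ?q\<bar>"
      using heat_kernel_ratio_bounds[OF s, of "int j"] by (intro mult_right_mono) auto
    also have "\<bar>?p - ?q\<bar> \<le> ?p + ?q"
      using measure_nonneg[of "walk s" "hit s (- (real n - real j))"] measure_nonneg[of "walk s" "- hit s (- (real n + real j))"]
      by linarith
    also have "?p + ?q \<le> C2 / (real j)\<^sup>2"
      using p q q' far unfolding C2_def add_divide_distrib by simp
    also have "\<dots> \<le> (C1 + C2) / (real j)\<^sup>2" using pos by (intro divide_right_mono) auto
    finally show ?thesis by simp
  qed
  then show ?thesis by (rule that)
qed

text \<open>Conditioning on the vertical displacement \<open>j\<close> and pairing \<open>j\<close> with \<open>- j\<close>.\<close>
lemma heat_solution_sums:
  assumes sol: "semidiscrete_heat_solution (\<mu> / s) \<Omega> w" and s: "s \<ge> 1"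
  shows "(\<lambda>k. tip_term n s (Suc k)) sums
    ((w 0 (- int n) (\<mu>\<^sup>2 / s) - 1 / 2) / heat_kernel s 0 - (measure (walk s) (hit s (- real n)) - 1 / 2))"
proof -
  define \<Lambda> where "\<Lambda> = {(i, j). (of_int i * (\<mu> / s), of_int j * (\<mu> / s)) \<in> \<Omega>}"
  \<comment> \<open>Indexing by the displacement from row \<open>- n\<close> makes opposite indices
    carry equal kernel weights.\<close>
  define A where "A j = measure (walk s) (hit s (- (real n - of_int j)))" for j :: int
  define g where "g j = heat_kernel s j * (A j - 1 / 2)" for j
  let ?W = "w 0 (- int n) (\<mu>\<^sup>2 / s)"
  have fin: "finite \<Lambda>"
    unfolding \<Lambda>_def using mu s by (intro finite_lattice_points bounded) auto
  have K: "heat_kernel s j = pmf (walk s) j" for j using s by (intro heat_kernel_eq_pmf) simp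
  have snd_in: "j \<in> snd ` \<Lambda>" if "(i, j) \<in> \<Lambda>" for i j
    using imageI[OF that, of snd] by simp
  have "?W = (\<Sum>(i, j)\<in>\<Lambda>. heat_kernel s i * heat_kernel s (j + int n))"
    using semidiscrete_heat_solution_eq[OF sol bounded, of "\<mu>\<^sup>2 / s" 0 "- int n"] mu s
    by (simp add: \<Lambda>_def power_divide power2_eq_square)
  also have "\<dots> = (\<Sum>j\<in>snd ` \<Lambda>. heat_kernel s (j + int n) * (\<Sum>i | (i, j) \<in> \<Lambda>. heat_kernel s i))"
  proof -
    have "finite {i. (i, j) \<in> \<Lambda>}" for j
      by (rule finite_subset[OF _ finite_imageI[OF fin, of fst]]) force
    then have "(\<Sum>j\<in>snd ` \<Lambda>. heat_kernel s (j + int n) * (\<Sum>i | (i, j) \<in> \<Lambda>. heat_kernel s i)) =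
        (\<Sum>(j, i)\<in>Sigma (snd ` \<Lambda>) (\<lambda>j. {i. (i, j) \<in> \<Lambda>}). heat_kernel s (j + int n) * heat_kernel s i)"
      using fin by (simp add: sum_distrib_left sum.Sigma)
    also have "\<dots> = (\<Sum>(i, j)\<in>\<Lambda>. heat_kernel s i * heat_kernel s (j + int n))"
      by (rule sum.reindex_bij_witness[of _ prod.swap prod.swap]) (auto simp: mult.commute snd_in)
    finally show ?thesis by simp
  qed
  also have "\<dots> = (\<Sum>j\<in>snd ` \<Lambda>. heat_kernel s (j + int n) * A (j + int n))"
  proof (intro sum.cong refl arg_cong2[of _ _ _ _ "(*)"])
    fix j
    have "finite {i. (i, j) \<in> \<Lambda>}"
      by (rule finite_subset[OF _ finite_imageI[OF fin, of fst]]) force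
    moreover have "{i. (i, j) \<in> \<Lambda>} = hit s (- (real n - of_int (j + int n)))"
      by (simp add: \<Lambda>_def hit_def)
    ultimately show "(\<Sum>i | (i, j) \<in> \<Lambda>. heat_kernel s i) = A (j + int n)"
      by (simp add: A_def K measure_measure_pmf_finite)
  qed
  also have "\<dots> = (\<Sum>j\<in>(\<lambda>j. j + int n) ` snd ` \<Lambda>. heat_kernel s j * A j)"
    by (subst sum.reindex) (auto simp: inj_on_def)
  finally have W: "?W = (\<Sum>j\<in>(\<lambda>j. j + int n) ` snd ` \<Lambda>. heat_kernel s j * A j)" .
  have "((\<lambda>j. heat_kernel s j * A j) has_sum ?W) UNIV"
  proof (rule has_sum_cong_neutral[THEN iffD1, OF _ _ _ has_sum_finite[of "(\<lambda>j. j + int n) ` snd ` \<Lambda>" "\<lambda>j. heat_kernel s j * A j", folded W]])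
    fix j assume j: "j \<in> UNIV - (\<lambda>j. j + int n) ` snd ` \<Lambda>"
    have "hit s (- (real n - of_int j)) = {}"
    proof (rule ccontr)
      assume "\<not> ?thesis"
      then obtain i where "(of_int i * (\<mu> / s), - (real n - of_int j) * (\<mu> / s)) \<in> \<Omega>"
        by (auto simp: hit_def)
      then have "(i, j - int n) \<in> \<Lambda>" by (simp add: \<Lambda>_def)
      then have "j \<in> (\<lambda>j. j + int n) ` snd ` \<Lambda>" by (force simp: image_iff)
      with j show False by simp
    qed
    then show "heat_kernel s j * A j = 0" by (simp add: A_def)
  qed (use fin in auto)
  moreover have "(heat_kernel s has_sum 1) UNIV"
    using has_sum_pmf[of "walk s"] by (simp add: K cong: has_sum_cong)
  \<comment> \<open>The total mass 1 of the kernel distributes the subtracted 1/2 over the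
    rows.\<close>
  ultimately have "((\<lambda>j. heat_kernel s j * A j + heat_kernel s j * (- 1 / 2)) has_sum (?W + 1 * (- 1 / 2))) UNIV"
    by (intro has_sum_add has_sum_cmult_left)
  then have g: "(g has_sum (?W - 1 / 2)) UNIV"
    by (simp add: g_def[abs_def] right_diff_distrib)
  have sub: "g summable_on X" for X
    by (rule summable_on_subset_banach[of g UNIV]) (use g in \<open>auto simp: summable_on_def\<close>)
  let ?P = "range (\<lambda>k. int (Suc k))" and ?N = "range (\<lambda>k. - int (Suc k))"
  have "(g has_sum (g 0 + (infsum g ?P + infsum g ?N))) ({0} \<union> (?P \<union> ?N))"
    by (intro has_sum_Un_disjoint has_sum_infsum sub) (auto simp: has_sum_finite_iff)
  also have "{0} \<union> (?P \<union> ?N) = UNIV"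
  proof -
    have "j \<in> {0} \<union> (?P \<union> ?N)" for j :: int
      by (cases j rule: int_cases3) (auto simp: image_iff gr0_conv_Suc)
    then show ?thesis by blast
  qed
  finally have eq: "?W - 1 / 2 = g 0 + (infsum g ?P + infsum g ?N)"
    using g has_sum_unique by blast
  have "((\<lambda>k. g (int (Suc k))) has_sum infsum g ?P) UNIV"
    using has_sum_infsum[OF sub[of ?P]] by (subst (asm) has_sum_reindex) (auto simp: inj_on_def o_def)
  moreover have "((\<lambda>k. g (- int (Suc k))) has_sum infsum g ?N) UNIV"
    using has_sum_infsum[OF sub[of ?N]] by (subst (asm) has_sum_reindex) (auto simp: inj_on_def o_def)
  ultimately have "((\<lambda>k. g (int (Suc k)) + g (- int (Suc k))) has_sum (infsum g ?P + infsum g ?N)) UNIV"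
    by (rule has_sum_add)
  then have "(\<lambda>k. g (int (Suc k)) + g (- int (Suc k))) sums (?W - 1 / 2 - g 0)"
    unfolding eq by (auto dest: has_sum_imp_sums)
  then have "(\<lambda>k. (g (int (Suc k)) + g (- int (Suc k))) / heat_kernel s 0) sums ((?W - 1 / 2 - g 0) / heat_kernel s 0)"
    by (rule sums_divide)
  moreover have "(g (int (Suc k)) + g (- int (Suc k))) / heat_kernel s 0 = tip_term n s (Suc k)" for k
    unfolding g_def K pmf_walk_uminus tip_term_def A_def by (simp add: algebra_simps add_divide_distrib diff_divide_distrib)
  moreover have "(?W - 1 / 2 - g 0) / heat_kernel s 0 =
      (?W - 1 / 2) / heat_kernel s 0 - (measure (walk s) (hit s (- real n)) - 1 / 2)"
    using heat_kernel_0_pos[OF s] by (simp add: g_def A_def diff_divide_distrib)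
  ultimately show ?thesis by simp
qed

end

section \<open>Passage to the limit and the sign of the deviation from 1/2\<close>

context parabolic_tip
begin

text \<open>The deviation of the solution from 1/2 in units of \<open>heat_kernel s 0\<close>. That
  positive factor decays like \<open>1 / sqrt s\<close>; dividing by it preserves the sign and
  leaves a limit that can be nonzero.\<close>

definition tip_sum :: "nat \<Rightarrow> real \<Rightarrow> real" where
  "tip_sum n s = measure (walk s) (hit s (- real n)) - 1 / 2 + (\<Sum>k. tip_term n s (Suc k))"

lemma heat_solution_eq_tip_sum:
  assumes "semidiscrete_heat_solution (\<mu> / s) \<Omega> w" "s \<ge> 1"
  shows "w 0 (- int n) (\<mu>\<^sup>2 / s) - 1 / 2 = heat_kernel s 0 * tip_sum n s"
proof -
  have "(w 0 (- int n) (\<mu>\<^sup>2 / s) - 1 / 2) / heat_kernel s 0 = tip_sum n s"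
    using sums_unique[OF heat_solution_sums[OF assms, of n]] unfolding tip_sum_def by linarith
  then show ?thesis
    using heat_kernel_0_pos[OF assms(2)] by (simp add: divide_eq_eq mult.commute)
qed

lemma tip_sum_tendsto:
  "((\<lambda>s. sqrt pi * tip_sum n s) \<longlongrightarrow> lower_total \<mu> \<kappa> n - upper_total \<mu> \<kappa> n) at_top"
proof -
  let ?B = "\<lambda>k. chi_square_cdf ((real n - real (Suc k)) / (\<mu> * \<kappa>)) + chi_square_cdf ((real n + real (Suc k)) / (\<mu> * \<kappa>)) - 1"
  obtain C where C: "\<And>s j. s \<ge> 1 \<Longrightarrow> j > n \<Longrightarrow> \<bar>tip_term n s j\<bar> \<le> C / (real j)\<^sup>2"
    using tip_term_bound[of n] by blast
  have "\<forall>\<^sub>F (k, s) in at_top \<times>\<^sub>F at_top. norm (tip_term n s (Suc k)) \<le> C * (1 / (real (Suc k))\<^sup>2)"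
    using eventually_prodI[OF eventually_ge_at_top[of n] eventually_ge_at_top[of "1::real"]]
    by (rule eventually_mono) (use C in \<open>auto simp: le_imp_less_Suc simp del: of_nat_Suc\<close>)
  moreover have "summable (\<lambda>k. C * (1 / (real (Suc k))\<^sup>2))"
    by (intro summable_mult) (use inverse_squares_sums in \<open>auto simp: sums_iff add.commute\<close>)
  \<comment> \<open>Besides the limit, Tannery's theorem supplies the summability of the limiting
    brackets that \<open>lower_total_minus_upper_total\<close> assumes.\<close>
  ultimately have T: "summable (\<lambda>k. norm (?B k)) \<and> ((\<lambda>s. \<Sum>k. tip_term n s (Suc k)) \<longlongrightarrow> (\<Sum>k. ?B k)) at_top"
    using tannerys_theorem[where a = "\<lambda>k s. tip_term n s (Suc k)" and b = ?B and F = at_top, OF tip_term_tendsto] by auto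
  have "((\<lambda>s. sqrt pi * tip_sum n s) \<longlongrightarrow> sqrt pi * (chi_square_cdf (real n / (\<mu> * \<kappa>)) - 1 / 2 + (\<Sum>k. ?B k))) at_top"
    unfolding tip_sum_def using T by (intro tendsto_intros hit_tendsto) auto
  then show ?thesis
    using T by (subst lower_total_minus_upper_total[OF mu kappa]) (auto intro: summable_norm_cancel)
qed

text \<open>With \<open>h = \<tau> / \<mu>\<close> the diffusive time is
  \<open>\<mu>^2 / \<tau>\<close>. Since \<open>tip_sum\<close> does not involve \<open>w\<close>,
  one range of \<open>\<tau>\<close> serves all solutions.\<close>

lemma heat_solution_sign:
  "\<forall>\<^sub>F \<tau> in at_right 0. \<forall>w. semidiscrete_heat_solution (\<tau> / \<mu>) \<Omega> w \<longrightarrow>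
     (lower_total \<mu> \<kappa> n < upper_total \<mu> \<kappa> n \<longrightarrow> w 0 (- int n) \<tau> < 1 / 2) \<and>
     (lower_total \<mu> \<kappa> n > upper_total \<mu> \<kappa> n \<longrightarrow> w 0 (- int n) \<tau> > 1 / 2)"
proof -
  let ?D = "lower_total \<mu> \<kappa> n - upper_total \<mu> \<kappa> n"
  have "\<forall>\<^sub>F s in at_top. 1 \<le> s \<and> (?D < 0 \<longrightarrow> sqrt pi * tip_sum n s < 0) \<and> (?D > 0 \<longrightarrow> sqrt pi * tip_sum n s > 0)"
  proof (intro eventually_conj)
    show "\<forall>\<^sub>F s in at_top. ?D < 0 \<longrightarrow> sqrt pi * tip_sum n s < 0"
      using order_tendstoD(2)[OF tip_sum_tendsto] by (cases "?D < 0") auto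
    show "\<forall>\<^sub>F s in at_top. ?D > 0 \<longrightarrow> sqrt pi * tip_sum n s > 0"
      using order_tendstoD(1)[OF tip_sum_tendsto] by (cases "?D > 0") auto
  qed (rule eventually_ge_at_top)
  moreover have "filterlim (\<lambda>\<tau>. \<mu>\<^sup>2 / \<tau>) at_top (at_right 0)"
    unfolding divide_inverse
    using mu by (intro filterlim_tendsto_pos_mult_at_top[OF tendsto_const] filterlim_inverse_at_top_right) auto
  ultimately have "\<forall>\<^sub>F \<tau> in at_right 0. 1 \<le> \<mu>\<^sup>2 / \<tau> \<and> (?D < 0 \<longrightarrow> sqrt pi * tip_sum n (\<mu>\<^sup>2 / \<tau>) < 0) \<and>
      (?D > 0 \<longrightarrow> sqrt pi * tip_sum n (\<mu>\<^sup>2 / \<tau>) > 0)"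
    by (rule eventually_compose_filterlim)
  with eventually_at_right_less[of "0::real"] show ?thesis
  proof eventually_elim
    case (elim \<tau>)
    have h: "\<mu> / (\<mu>\<^sup>2 / \<tau>) = \<tau> / \<mu>" "\<mu>\<^sup>2 / (\<mu>\<^sup>2 / \<tau>) = \<tau>"
      using mu elim by (auto simp: power2_eq_square)
    have eq: "w 0 (- int n) \<tau> - 1 / 2 = heat_kernel (\<mu>\<^sup>2 / \<tau>) 0 * tip_sum n (\<mu>\<^sup>2 / \<tau>)"
      if "semidiscrete_heat_solution (\<tau> / \<mu>) \<Omega> w" for w
      using heat_solution_eq_tip_sum[of "\<mu>\<^sup>2 / \<tau>" w n] that elim unfolding h by auto
    have pos: "heat_kernel (\<mu>\<^sup>2 / \<tau>) 0 > 0" using elim by (intro heat_kernel_0_pos) auto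
    show ?case
    proof (intro allI impI conjI)
      fix w assume w: "semidiscrete_heat_solution (\<tau> / \<mu>) \<Omega> w"
      show "w 0 (- int n) \<tau> < 1 / 2" if "lower_total \<mu> \<kappa> n < upper_total \<mu> \<kappa> n"
      proof -
        have "tip_sum n (\<mu>\<^sup>2 / \<tau>) < 0" using elim that by (simp add: mult_less_0_iff)
        from mult_pos_neg[OF pos this] show ?thesis using eq[OF w] by linarith
      qed
      show "w 0 (- int n) \<tau> > 1 / 2" if "lower_total \<mu> \<kappa> n > upper_total \<mu> \<kappa> n"
      proof -
        have "tip_sum n (\<mu>\<^sup>2 / \<tau>) > 0" using elim that by (simp add: zero_less_mult_iff)
        from mult_pos_pos[OF pos this] show ?thesis using eq[OF w] by linarith
      qed
    qed
  qed
qed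

end

section \<open>Second-order expansion of the boundary, and the theorem\<close>

lemma taylor_second_order_at_0:
  fixes f :: "real \<Rightarrow> real"
  assumes "c > 0" "C_k_on 2 {-c<..<c} f" "f 0 = 0" "deriv f 0 = 0" "\<epsilon> > 0"
  shows "\<exists>\<delta>>0. \<forall>x. \<bar>x\<bar> < \<delta> \<longrightarrow> \<bar>f x - deriv (deriv f) 0 * x\<^sup>2 / 2\<bar> \<le> \<epsilon> * x\<^sup>2"
proof -
  let ?d = "deriv (deriv f) 0"
  have f: "(f has_real_derivative deriv f x) (at x)" and f': "(deriv f has_real_derivative deriv (deriv f) x) (at x)"
    if "\<bar>x\<bar> < c" for x
    using assms(2) that unfolding C_k_on_def
    by (auto simp: less_2_cases_iff DERIV_deriv_iff_field_differentiable abs_less_iff)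
  \<comment> \<open>Differentiability of \<open>deriv f\<close> at 0 controls the derivative of the
    remainder by \<open>\<epsilon> * \<bar>x\<bar>\<close>; the mean value inequality then controls
    the remainder itself.\<close>
  have "((\<lambda>x. deriv f x / x) \<longlongrightarrow> ?d) (at 0)"
    using f'[of 0] assms by (simp add: DERIV_def)
  then obtain \<delta>' where \<delta>': "\<delta>' > 0" "\<And>x. x \<noteq> 0 \<Longrightarrow> \<bar>x\<bar> < \<delta>' \<Longrightarrow> \<bar>deriv f x / x - ?d\<bar> < \<epsilon>"
    using assms(5) by (auto simp: LIM_eq)
  have d1: "\<bar>deriv f x - ?d * x\<bar> \<le> \<epsilon> * \<bar>x\<bar>" if "\<bar>x\<bar> < \<delta>'" for x
  proof (cases "x = 0")
    case False
    have "\<bar>deriv f x - ?d * x\<bar> = \<bar>deriv f x / x - ?d\<bar> * \<bar>x\<bar>"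
      using False by (simp add: abs_mult[symmetric] field_simps)
    also have "\<dots> \<le> \<epsilon> * \<bar>x\<bar>" using \<delta>'(2)[OF False that] by (intro mult_right_mono) auto
    finally show ?thesis .
  qed (simp add: assms)
  have "\<bar>f x - ?d * x\<^sup>2 / 2\<bar> \<le> \<epsilon> * x\<^sup>2" if x: "\<bar>x\<bar> < min c \<delta>'" for x
  proof -
    have "norm ((f x - ?d * x\<^sup>2 / 2) - (f 0 - ?d * 0\<^sup>2 / 2)) \<le> (\<epsilon> * \<bar>x\<bar>) * norm (x - 0)"
    proof (rule field_differentiable_bound[where S = "{- \<bar>x\<bar>..\<bar>x\<bar>}" and f' = "\<lambda>z. deriv f z - ?d * z"])
      fix z assume z: "z \<in> {- \<bar>x\<bar>..\<bar>x\<bar>}"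
      show "((\<lambda>x. f x - ?d * x\<^sup>2 / 2) has_field_derivative deriv f z - ?d * z) (at z within {- \<bar>x\<bar>..\<bar>x\<bar>})"
        using x z by (auto intro!: derivative_eq_intros DERIV_subset[OF f])
      have "\<epsilon> * \<bar>z\<bar> \<le> \<epsilon> * \<bar>x\<bar>" using z assms(5) by (intro mult_left_mono) auto
      moreover have "\<bar>z\<bar> < \<delta>'" using x z by (auto simp: abs_less_iff)
      ultimately show "norm (deriv f z - ?d * z) \<le> \<epsilon> * \<bar>x\<bar>"
        using d1[of z] by simp
    qed auto
    then show ?thesis using assms by (simp add: power2_eq_square)
  qed
  then show ?thesis using \<delta>'(1) assms(1) by (intro exI[of _ "min c \<delta>'"]) auto
qed

text \<open>When the two totals coincide, the limit is 0 and leaves the sign of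
  \<open>w - 1/2\<close> open, so the equivalence is claimed only for distinct totals. The two
  implications from \<open>w\<close> to the totals hold in the tie as well, their conclusions then
  being true.\<close>

theorem theorem2:
  fixes \<Omega> :: "(real \<times> real) set"
    and f :: "real \<Rightarrow> real"
    and c\<^sub>0 \<kappa> \<mu> :: real
    and n :: nat
  assumes "\<mu> > 0"
    and "bounded_smooth_domain \<Omega>"
    and "c\<^sub>0 > 0"
    and "\<Omega> \<inter> ({-c\<^sub>0<..<c\<^sub>0} \<times> {-c\<^sub>0<..<c\<^sub>0}) =
           {(x, y). \<bar>x\<bar> < c\<^sub>0 \<and> -c\<^sub>0 < y \<and> y \<le> f x \<and> f x < c\<^sub>0}"
    and "C_k_on 2 {-c\<^sub>0<..<c\<^sub>0} f"
    and "\<forall>x\<in>{-c\<^sub>0<..<c\<^sub>0}. f (- x) = f x"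
    and "f 0 = 0"
    and "deriv f 0 = 0"
    and "deriv (deriv f) 0 = - \<kappa>"
    and "- \<kappa> \<le> 0"
    and "\<kappa> \<noteq> 0"
  shows "\<forall>\<^sub>F \<tau> in at_right 0. \<forall>w. semidiscrete_heat_solution (\<tau> / \<mu>) \<Omega> w \<longrightarrow>
           (lower_total \<mu> \<kappa> n \<noteq> upper_total \<mu> \<kappa> n \<longrightarrow>
              (w 0 (- int n) \<tau> \<le> 1/2 \<longleftrightarrow> lower_total \<mu> \<kappa> n \<le> upper_total \<mu> \<kappa> n)) \<and>
           (w 0 (- int n) \<tau> \<le> 1/2 \<longrightarrow> lower_total \<mu> \<kappa> n \<le> upper_total \<mu> \<kappa> n) \<and>
           (w 0 (- int n) \<tau> = 1/2 \<longrightarrow> lower_total \<mu> \<kappa> n = upper_total \<mu> \<kappa> n)"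
proof -
  have kappa: "\<kappa> > 0" using assms by simp
  interpret parabolic_tip \<Omega> f c\<^sub>0 \<kappa> \<mu>
  proof
    fix \<epsilon> :: real assume "\<epsilon> > 0"
    with taylor_second_order_at_0[OF assms(3,5,7,8)] obtain \<delta> where \<delta>: "\<delta> > 0"
      "\<And>x. \<bar>x\<bar> < \<delta> \<Longrightarrow> \<bar>f x + \<kappa> * x\<^sup>2 / 2\<bar> \<le> \<epsilon> * x\<^sup>2"
      by (auto simp: assms(9))
    \<comment> \<open>Tolerance \<open>\<kappa> / 2\<close> forces \<open>f x \<le> 0\<close> near
      the origin, which secures the clause \<open>f x < c\<^sub>0\<close> in the description of the
      region.\<close>
    from taylor_second_order_at_0[OF assms(3,5,7,8), of "\<kappa> / 2"] kappa obtain \<delta>' where \<delta>': "\<delta>' > 0"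
      "\<And>x. \<bar>x\<bar> < \<delta>' \<Longrightarrow> \<bar>f x + \<kappa> * x\<^sup>2 / 2\<bar> \<le> \<kappa> / 2 * x\<^sup>2"
      by (auto simp: assms(9))
    have "(x, y) \<in> \<Omega> \<longleftrightarrow> y \<le> f x" if "\<bar>x\<bar> < min \<delta>' c\<^sub>0" "\<bar>y\<bar> < c\<^sub>0" for x y
    proof -
      have "f x \<le> 0" using abs_le_D1[OF \<delta>'(2)[of x]] that by simp
      moreover have "(x, y) \<in> \<Omega> \<longleftrightarrow> (x, y) \<in> \<Omega> \<inter> ({-c\<^sub>0<..<c\<^sub>0} \<times> {-c\<^sub>0<..<c\<^sub>0})"
        using that by auto
      ultimately show ?thesis
        using that assms(3) unfolding assms(4) by auto
    qed
    then show "\<exists>\<delta>>0. \<forall>x y. \<bar>x\<bar> < \<delta> \<longrightarrow> \<bar>y\<bar> < c\<^sub>0 \<longrightarrow>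
        ((x, y) \<in> \<Omega> \<longleftrightarrow> y \<le> f x) \<and> \<bar>f x + \<kappa> * x\<^sup>2 / 2\<bar> \<le> \<epsilon> * x\<^sup>2"
      using \<delta> \<delta>'(1) assms(3) by (intro exI[of _ "min \<delta> (min \<delta>' c\<^sub>0)"]) auto
  qed (use assms(1,2,3) kappa in \<open>auto simp: bounded_smooth_domain_def\<close>)
  from heat_solution_sign[of n] show ?thesis
  proof (eventually_elim, intro allI impI)
    fix \<tau> w
    assume "\<forall>w. semidiscrete_heat_solution (\<tau> / \<mu>) \<Omega> w \<longrightarrow>
        (lower_total \<mu> \<kappa> n < upper_total \<mu> \<kappa> n \<longrightarrow> w 0 (- int n) \<tau> < 1 / 2) \<and>
        (lower_total \<mu> \<kappa> n > upper_total \<mu> \<kappa> n \<longrightarrow> w 0 (- int n) \<tau> > 1 / 2)"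
      and "semidiscrete_heat_solution (\<tau> / \<mu>) \<Omega> w"
    then have "lower_total \<mu> \<kappa> n < upper_total \<mu> \<kappa> n \<longrightarrow> w 0 (- int n) \<tau> < 1 / 2"
      "lower_total \<mu> \<kappa> n > upper_total \<mu> \<kappa> n \<longrightarrow> w 0 (- int n) \<tau> > 1 / 2"
      by blast+
    then show "(lower_total \<mu> \<kappa> n \<noteq> upper_total \<mu> \<kappa> n \<longrightarrow>
              (w 0 (- int n) \<tau> \<le> 1/2 \<longleftrightarrow> lower_total \<mu> \<kappa> n \<le> upper_total \<mu> \<kappa> n)) \<and>
           (w 0 (- int n) \<tau> \<le> 1/2 \<longrightarrow> lower_total \<mu> \<kappa> n \<le> upper_total \<mu> \<kappa> n) \<and>
           (w 0 (- int n) \<tau> = 1/2 \<longrightarrow> lower_total \<mu> \<kappa> n = upper_total \<mu> \<kappa> n)"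
      by (cases "lower_total \<mu> \<kappa> n" "upper_total \<mu> \<kappa> n" rule: linorder_cases) auto
  qed
qed

end
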